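(* Let $m\ge2$ and $k\in\{1,\dots,m-1\}$ be integers. Let $\varphi\in C^\infty(X)$ be a $\tilde g$-admissible and $G$-invariant function with $\sup_X\varphi=0$. Then $\varphi\ge\tilde\psi$ on $X$.
   Context: $X$ is the blow-up of $\mathbb{P}_m\mathbb{C}$ along $\{[0,\dots,0,z_{k+1},\dots,z_m]\}\cong\mathbb{P}_{m-k-1}\mathbb{C}$, realised as the submanifold of $\mathbb{P}_m\mathbb{C}\times\mathbb{P}_k\mathbb{C}$ of points $([z_0,\dots,z_m],[\zeta_0,\dots,\zeta_k])$ such that the vectors $(z_0,\dots,z_k)$ and $(\zeta_0,\dots,\zeta_k)$ of $\mathbb{C}^{k+1}$ are collinear. Let $\pi_1,\pi_2$ be the projections of $X$ to $\mathbb{P}_m\mathbb{C}$ and $\mathbb{P}_k\mathbb{C}$. Write $\partial_{\lambda\bar\mu}=\frac{\partial^2}{\partial z_\lambda\partial\bar z_\mu}$. Metric: $\tilde g=(m+1-k)\pi_1^*g_m+k\,\pi_2^*g_k$, where $g_n$ is the Fubini–Study metric of $\mathbb{P}_n\mathbb{C}$ with components $\partial_{\lambda\bar\mu}\ln(1+|z_1|^2+\dots+|z_n|^2)$ in the chart $z_0=1$. Thus in the dense chart of points $([1,z_1,\dots,z_m],[1,z_1,\dots,z_k])$, $\tilde g_{\lambda\bar\mu}=(m+1-k)\partial_{\lambda\bar\mu}\ln(1+|z_1|^2+\dots+|z_m|^2)+k\,\partial_{\lambda\bar\mu}\ln(1+|z_1|^2+\dots+|z_k|^2)$. A real function $\varphi\in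 C^\infty(X)$ is $\tilde g$-admissible if the Hermitian matrix $(\tilde g_{\lambda\bar\mu}+\partial_{\lambda\bar\mu}\varphi)$ is positive definite at every point of $X$ (in local holomorphic coordinates). Group: $G$ is the group of automorphisms of $X$ naturally induced by the automorphisms of $\mathbb{P}_m\mathbb{C}$ exchanging $z_i$ and $z_j$ ($i,j\in\{0,\dots,k\}$), exchanging $z_p$ and $z_q$ ($p,q\in\{k+1,\dots,m\}$), and replacing $z_l$ by $z_le^{i\theta}$ ($l\in\{0,\dots,m\}$, $\theta\in[0,2\pi]$); on $X$ the coordinates $\zeta_0,\dots,\zeta_k$ are transformed in the same way as $z_0,\dots,z_k$. The function $\tilde\psi=\inf(\tilde\psi_1,\tilde\psi_2)$, where at the point $([z_0,\dots,z_m],[\zeta_0,\dots,\zeta_k])\in X$ $$\tilde\psi_1=\ln\frac{(|z_0|\cdots|z_k|)^{\frac{2(m+1-k)}{k+1}}(|\zeta_0|\cdots|\zeta_k|)^{\frac{2k}{k+1}}}{(|z_0|^2+\dots+|z_m|^2)^{m+1-k}(|\zeta_0|^2+\dots+|\zeta_k|^2)^{k}},$$ $$\tilde\psi_2=\ln\frac{(|z_{k+1}|\cdots|z_m|)^{\frac{2(m+1-k)}{m-k}}(|\zeta_0|\cdots|\zeta_k|)^{\frac{2k}{k+1}}}{(|z_0|^2+\dots+|z_m|^2)^{m+1-k}(|\zeta_0|^2+\dots+|\zeta_k|^2)^{k}}.$$ These are finite where no coordinate vanishes; with the convention $\ln0=-\infty$, $\tilde\psi=-\infty$ where some coordinate vanishes.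 *)

theory Defs
  imports "HOL-Analysis.Analysis" "HOL-Combinatorics.Transposition"
begin

type_synonym cvec = "nat \<Rightarrow> complex"

text \<open>
  The space of complex vectors with coordinates indexed by a (finite) set \<open>I\<close>. Vectors are
  functions vanishing outside \<open>I\<close>, so that \<open>\<complex>\<^sup>{\<^sup>k\<^sup>+\<^sup>1\<^sup>}\<close> is a subspace of \<open>\<complex>\<^sup>{\<^sup>m\<^sup>+\<^sup>1\<^sup>}\<close> for
  \<open>k \<le> m\<close>. The topology is that of pointwise convergence, i.e. the usual one when \<open>I\<close> is finite.
\<close>
definition Cn :: "nat set \<Rightarrow> cvec set" where
  "Cn I = {u. \<forall>j. j \<notin> I \<longrightarrow> u j = 0}"


subsection \<open>Differential calculus on coordinate spaces\<close>

text \<open>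
  Real partial derivative in the direction \<open>d\<close> of the \<open>j\<close>-th complex coordinate
  \<open>z\<^sub>j = x\<^sub>j + \<i>y\<^sub>j\<close>: \<open>d = 1\<close> gives the derivative in \<open>x\<^sub>j\<close>, \<open>d = \<i>\<close> the one in \<open>y\<^sub>j\<close>.
\<close>
definition rpart :: "complex \<Rightarrow> nat \<Rightarrow> (cvec \<Rightarrow> 'b::real_normed_vector) \<Rightarrow> cvec \<Rightarrow> 'b" where
  "rpart d j f u = vector_derivative (\<lambda>t::real. f (u(j := u j + of_real t * d))) (at 0)"

fun Ck_on_Cn :: "nat set \<Rightarrow> nat \<Rightarrow> (cvec \<Rightarrow> 'b::real_normed_vector) \<Rightarrow> bool" where
  "Ck_on_Cn I 0 f \<longleftrightarrow> continuous_on (Cn I) f"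
| "Ck_on_Cn I (Suc r) f \<longleftrightarrow> continuous_on (Cn I) f \<and>
     (\<forall>j\<in>I. \<forall>d\<in>{1, \<i>}.
        (\<forall>u\<in>Cn I. (\<lambda>t::real. f (u(j := u j + of_real t * d))) differentiable (at 0)) \<and>
        Ck_on_Cn I r (rpart d j f))"

definition smooth_on_Cn :: "nat set \<Rightarrow> (cvec \<Rightarrow> 'b::real_normed_vector) \<Rightarrow> bool" where
  "smooth_on_Cn I f \<longleftrightarrow> (\<forall>r. Ck_on_Cn I r f)"

definition dz :: "nat \<Rightarrow> (cvec \<Rightarrow> complex) \<Rightarrow> cvec \<Rightarrow> complex" where
  "dz j f u = (rpart 1 j f u - \<i> * rpart \<i> j f u) / 2"

definition dzbar :: "nat \<Rightarrow> (cvec \<Rightarrow> complex) \<Rightarrow> cvec \<Rightarrow> complex" where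
  "dzbar j f u = (rpart 1 j f u + \<i> * rpart \<i> j f u) / 2"

definition ddbar :: "nat \<Rightarrow> nat \<Rightarrow> (cvec \<Rightarrow> real) \<Rightarrow> cvec \<Rightarrow> complex" where
  "ddbar a b f = dz a (dzbar b (\<lambda>u. of_real (f u)))"

definition pos_def_hermitian :: "nat set \<Rightarrow> (nat \<Rightarrow> nat \<Rightarrow> complex) \<Rightarrow> bool" where
  "pos_def_hermitian I H \<longleftrightarrow>
     (\<forall>a\<in>I. \<forall>b\<in>I. H b a = cnj (H a b)) \<and>
     (\<forall>v. (\<exists>a\<in>I. v a \<noteq> 0) \<longrightarrow> 0 < Re (\<Sum>a\<in>I. \<Sum>b\<in>I. H a b * v a * cnj (v b)))"

text \<open>
  Components of the pull-back under a holomorphic map \<open>F\<close> of the Hermitian form with components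
  \<open>h\<^sub>a\<^sub>b\<close>, linear in the index \<open>a\<close> and antilinear in \<open>b\<close> (both running over \<open>J\<close>).
\<close>
definition pullback_form ::
  "nat set \<Rightarrow> (nat \<Rightarrow> nat \<Rightarrow> cvec \<Rightarrow> complex) \<Rightarrow> (cvec \<Rightarrow> cvec) \<Rightarrow> nat \<Rightarrow> nat \<Rightarrow> cvec \<Rightarrow> complex" where
  "pullback_form J h F l n u =
     (\<Sum>a\<in>J. \<Sum>b\<in>J. h a b (F u) * dz l (\<lambda>w. F w a) u * cnj (dz n (\<lambda>w. F w b) u))"


subsection \<open>Projective spaces and the Fubini--Study metric\<close>

text \<open>The point with homogeneous coordinates \<open>z\<close>, as the line through \<open>z\<close>.\<close>
definition pline :: "cvec \<Rightarrow> cvec set" where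
  "pline z = {w. \<exists>c. w = (\<lambda>i. c * z i)}"

text \<open>
  Components of the Fubini--Study metric of \<open>\<P>\<^sub>n\<close> in the chart \<open>z\<^sub>i = 1\<close>, with coordinates
  \<open>z\<^sub>l\<close>, \<open>l \<in> {..n} - {i}\<close>.
\<close>
definition fubini_study :: "nat \<Rightarrow> nat \<Rightarrow> nat \<Rightarrow> nat \<Rightarrow> cvec \<Rightarrow> complex" where
  "fubini_study n i a b = ddbar a b (\<lambda>v. ln (1 + (\<Sum>l\<in>{..n} - {i}. (cmod (v l))\<^sup>2)))"


subsection \<open>The blow-up\<close>

definition homog_coords :: "nat \<Rightarrow> nat \<Rightarrow> (cvec \<times> cvec) set" where
  "homog_coords m k = {(z, \<zeta>). z \<in> Cn {..m} \<and> z \<noteq> (\<lambda>_. 0) \<and> \<zeta> \<in> Cn {..k} \<and> \<zeta> \<noteq> (\<lambda>_. 0) \<and>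
     (\<exists>a b. (a \<noteq> 0 \<or> b \<noteq> 0) \<and> (\<forall>i\<le>k. a * z i + b * \<zeta> i = 0))}"

definition bpoint :: "cvec \<Rightarrow> cvec \<Rightarrow> cvec set \<times> cvec set" where
  "bpoint z \<zeta> = (pline z, pline \<zeta>)"

definition blowup :: "nat \<Rightarrow> nat \<Rightarrow> (cvec set \<times> cvec set) set" where
  "blowup m k = (\<lambda>(z, \<zeta>). bpoint z \<zeta>) ` homog_coords m k"

text \<open>
  Holomorphic atlas. The chart \<open>(i, j)\<close>, where \<open>i \<le> k\<close> and either \<open>j = i\<close> or \<open>k < j \<le> m\<close>, covers
  the points with \<open>\<zeta>\<^sub>i \<noteq> 0\<close> and \<open>z\<^sub>j \<noteq> 0\<close>; they are normalised by \<open>\<zeta>\<^sub>i = 1\<close>, \<open>z\<^sub>j = 1\<close>. The local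
  coordinates are \<open>u\<^sub>l\<close>, \<open>l \<in> {..m} - {j}\<close>:
  \<^item> if \<open>j = i\<close>, they are the \<open>z\<^sub>l\<close>, and \<open>\<zeta> = (z\<^sub>0, \<dots>, z\<^sub>k)\<close>;
  \<^item> if \<open>j > k\<close>, they are \<open>z\<^sub>l\<close> for \<open>l > k\<close>, \<open>\<zeta>\<^sub>l\<close> for \<open>l \<le> k\<close>, \<open>l \<noteq> i\<close>, and the blow-up parameter
    \<open>u\<^sub>i = z\<^sub>i\<close>, for which \<open>(z\<^sub>0, \<dots>, z\<^sub>k) = u\<^sub>i \<zeta>\<close>.

  The dense chart of points \<open>([1, z\<^sub>1, \<dots>, z\<^sub>m], [1, z\<^sub>1, \<dots>, z\<^sub>k])\<close> is the chart \<open>(0, 0)\<close>.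
\<close>
definition charts :: "nat \<Rightarrow> nat \<Rightarrow> (nat \<times> nat) set" where
  "charts m k = {(i, j). i \<le> k \<and> (j = i \<or> k < j \<and> j \<le> m)}"

text \<open>
  The projections \<open>\<pi>\<^sub>1\<close> and \<open>\<pi>\<^sub>2\<close> in local coordinates, as maps from the chart \<open>(i, j)\<close> to the
  charts \<open>z\<^sub>j = 1\<close> of \<open>\<P>\<^sub>m\<close> and \<open>\<zeta>\<^sub>i = 1\<close> of \<open>\<P>\<^sub>k\<close>.
\<close>
definition proj1 :: "nat \<Rightarrow> nat \<Rightarrow> nat \<Rightarrow> cvec \<Rightarrow> cvec" where
  "proj1 k i j u = (if j = i then u else (\<lambda>l. if l \<le> k \<and> l \<noteq> i then u i * u l else u l))"

definition proj2 :: "nat \<Rightarrow> nat \<Rightarrow> cvec \<Rightarrow> cvec" where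
  "proj2 k i u = (\<lambda>l. if l \<le> k \<and> l \<noteq> i then u l else 0)"

definition chart_point :: "nat \<Rightarrow> nat \<Rightarrow> nat \<Rightarrow> cvec \<Rightarrow> cvec set \<times> cvec set" where
  "chart_point k i j u = bpoint ((proj1 k i j u)(j := 1)) ((proj2 k i u)(i := 1))"

definition smooth_on_blowup :: "nat \<Rightarrow> nat \<Rightarrow> (cvec set \<times> cvec set \<Rightarrow> real) \<Rightarrow> bool" where
  "smooth_on_blowup m k \<phi> \<longleftrightarrow>
     (\<forall>(i, j)\<in>charts m k. smooth_on_Cn ({..m} - {j}) (\<lambda>u. \<phi> (chart_point k i j u)))"

definition blowup_metric :: "nat \<Rightarrow> nat \<Rightarrow> nat \<Rightarrow> nat \<Rightarrow> nat \<Rightarrow> nat \<Rightarrow> cvec \<Rightarrow> complex" where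
  "blowup_metric m k i j l n u =
     of_nat (m + 1 - k) * pullback_form ({..m} - {j}) (fubini_study m j) (proj1 k i j) l n u +
     of_nat k * pullback_form ({..k} - {i}) (fubini_study k i) (proj2 k i) l n u"

definition admissible :: "nat \<Rightarrow> nat \<Rightarrow> (cvec set \<times> cvec set \<Rightarrow> real) \<Rightarrow> bool" where
  "admissible m k \<phi> \<longleftrightarrow>
     (\<forall>(i, j)\<in>charts m k. \<forall>u\<in>Cn ({..m} - {j}).
        pos_def_hermitian ({..m} - {j})
          (\<lambda>l n. blowup_metric m k i j l n u + ddbar l n (\<lambda>w. \<phi> (chart_point k i j w)) u))"


subsection \<open>The automorphism group\<close>

definition exchange :: "nat \<Rightarrow> nat \<Rightarrow> cvec \<Rightarrow> cvec" where
  "exchange i j z = z \<circ> Transposition.transpose i j"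

definition rotate_coord :: "nat \<Rightarrow> real \<Rightarrow> cvec \<Rightarrow> cvec" where
  "rotate_coord l \<theta> z = z(l := z l * exp (\<i> * of_real \<theta>))"

definition coord_maps :: "nat \<Rightarrow> nat \<Rightarrow> (cvec \<Rightarrow> cvec) set" where
  "coord_maps m k =
     {exchange i j | i j. i \<le> k \<and> j \<le> k} \<union>
     {exchange p q | p q. p \<in> {k+1..m} \<and> q \<in> {k+1..m}} \<union>
     {rotate_coord l \<theta> | l \<theta>. l \<le> m \<and> \<theta> \<in> {0..2*pi}}"

text \<open>
  A linear map \<open>T\<close> acts on lines by taking images. Since vectors of \<open>\<complex>\<^sup>{\<^sup>k\<^sup>+\<^sup>1\<^sup>}\<close> vanish beyond the
  index \<open>k\<close>, the same \<open>T\<close> describes the action on the \<open>\<zeta>\<close> coordinates.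
\<close>
definition induced :: "(cvec \<Rightarrow> cvec) \<Rightarrow> cvec set \<times> cvec set \<Rightarrow> cvec set \<times> cvec set" where
  "induced T = (\<lambda>(L, M). (T ` L, T ` M))"

text \<open>
  Inverses need not be added: exchanges are involutions, and the rotation by \<open>2\<pi> - \<theta>\<close> inverts
  the rotation by \<open>\<theta>\<close>.
\<close>
inductive_set aut_group :: "nat \<Rightarrow> nat \<Rightarrow> (cvec set \<times> cvec set \<Rightarrow> cvec set \<times> cvec set) set"
  for m k :: nat where
  "id \<in> aut_group m k"
| "T \<in> coord_maps m k \<Longrightarrow> g \<in> aut_group m k \<Longrightarrow> induced T \<circ> g \<in> aut_group m k"

definition invariant :: "nat \<Rightarrow> nat \<Rightarrow> (cvec set \<times> cvec set \<Rightarrow> real) \<Rightarrow> bool" where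
  "invariant m k \<phi> \<longleftrightarrow> (\<forall>g\<in>aut_group m k. \<forall>x\<in>blowup m k. \<phi> (g x) = \<phi> x)"


subsection \<open>The lower envelope\<close>

definition eln :: "real \<Rightarrow> ereal" where
  "eln x = (if x = 0 then -\<infinity> else ereal (ln x))"

text \<open>Functions of homogeneous coordinates, invariant under rescaling of \<open>z\<close> and of \<open>\<zeta>\<close>.\<close>

definition psi1 :: "nat \<Rightarrow> nat \<Rightarrow> cvec \<Rightarrow> cvec \<Rightarrow> ereal" where
  "psi1 m k z \<zeta> = eln (
     ((\<Prod>i\<in>{0..k}. cmod (z i)) powr (2 * real (m + 1 - k) / real (k + 1)) *
      (\<Prod>i\<in>{0..k}. cmod (\<zeta> i)) powr (2 * real k / real (k + 1))) /
     ((\<Sum>i\<in>{0..m}. (cmod (z i))\<^sup>2) ^ (m + 1 - k) * (\<Sum>i\<in>{0..k}. (cmod (\<zeta> i))\<^sup>2) ^ k))"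

definition psi2 :: "nat \<Rightarrow> nat \<Rightarrow> cvec \<Rightarrow> cvec \<Rightarrow> ereal" where
  "psi2 m k z \<zeta> = eln (
     ((\<Prod>p\<in>{k+1..m}. cmod (z p)) powr (2 * real (m + 1 - k) / real (m - k)) *
      (\<Prod>i\<in>{0..k}. cmod (\<zeta> i)) powr (2 * real k / real (k + 1))) /
     ((\<Sum>i\<in>{0..m}. (cmod (z i))\<^sup>2) ^ (m + 1 - k) * (\<Sum>i\<in>{0..k}. (cmod (\<zeta> i))\<^sup>2) ^ k))"

definition psi :: "nat \<Rightarrow> nat \<Rightarrow> cvec \<Rightarrow> cvec \<Rightarrow> ereal" where
  "psi m k z \<zeta> = inf (psi1 m k z \<zeta>) (psi2 m k z \<zeta>)"


subsection \<open>The atlas covers the blow-up; the metric in the dense chart\<close>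

lemma pline_scale: "c \<noteq> 0 \<Longrightarrow> pline (\<lambda>i. c * z i) = pline z"
proof -
  assume c: "c \<noteq> 0"
  have "(\<lambda>i. d * (c * z i)) = (\<lambda>i. (d * c) * z i)" "(\<lambda>i. d * z i) = (\<lambda>i. (d / c) * (c * z i))" for d
    using c by auto
  then show ?thesis unfolding pline_def by blast
qed

lemma blowup_eq_charts:
  assumes "k < m"
  shows "blowup m k = (\<Union>(i, j)\<in>charts m k. chart_point k i j ` Cn ({..m} - {j}))"
proof (intro subset_antisym subsetI)
  fix x assume "x \<in> blowup m k"
  then obtain z \<zeta> where h: "(z, \<zeta>) \<in> homog_coords m k" and x: "x = bpoint z \<zeta>"
    by (auto simp: blowup_def)
  then have z: "z \<in> Cn {..m}" "z \<noteq> (\<lambda>_. 0)" and \<zeta>: "\<zeta> \<in> Cn {..k}" "\<zeta> \<noteq> (\<lambda>_. 0)"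
    by (auto simp: homog_coords_def)
  from h obtain a b where ab: "a \<noteq> 0 \<or> b \<noteq> 0" "\<And>i. i \<le> k \<Longrightarrow> a * z i + b * \<zeta> i = 0"
    by (auto simp: homog_coords_def)
  from \<zeta> obtain i where i: "i \<le> k" "\<zeta> i \<noteq> 0" by (auto simp: Cn_def) (metis atMost_iff)
  have "a \<noteq> 0" using ab i by force
  define t where "t = - b / a"
  have t: "z l = t * \<zeta> l" if "l \<le> k" for l
    using ab(2)[OF that] \<open>a \<noteq> 0\<close> by (simp add: t_def field_simps add_eq_0_iff)
  show "x \<in> (\<Union>(i, j)\<in>charts m k. chart_point k i j ` Cn ({..m} - {j}))"
  proof (cases "t = 0")
    case False
    define u where "u = (\<lambda>l. if l = i then 0 else z l / z i)"
    have zi: "z i \<noteq> 0" using t[OF i(1)] i False by simp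
    have u: "u \<in> Cn ({..m} - {i})" using z by (auto simp: u_def Cn_def)
    have 1: "(proj1 k i i u)(i := 1) = (\<lambda>l. (1 / z i) * z l)"
      using zi by (auto simp: proj1_def u_def)
    have 2: "(proj2 k i u)(i := 1) = (\<lambda>l. (1 / \<zeta> i) * \<zeta> l)"
      using zi i t False \<zeta>(1) by (auto simp: proj2_def u_def Cn_def fun_eq_iff)
    have "x = chart_point k i i u"
      unfolding chart_point_def 1 2 x bpoint_def
      using pline_scale[of "1 / z i" z] pline_scale[of "1 / \<zeta> i" \<zeta>] zi i by simp
    moreover have "(i, i) \<in> charts m k" using i by (simp add: charts_def)
    ultimately show ?thesis using u by force
  next
    case True
    then have z0: "z l = 0" if "l \<le> k" for l using t that by simp
    from z obtain p where p: "p \<le> m" "z p \<noteq> 0" by (auto simp: Cn_def) (metis atMost_iff)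
    have pk: "k < p" using p z0 by (meson not_le)
    define u where "u = (\<lambda>l. if l = i \<or> l = p then 0 else if l \<le> k then \<zeta> l / \<zeta> i else z l / z p)"
    have u: "u \<in> Cn ({..m} - {p})" using z assms by (auto simp: u_def Cn_def)
    have 1: "(proj1 k i p u)(p := 1) = (\<lambda>l. (1 / z p) * z l)"
      using p pk i z0 by (auto simp: proj1_def u_def fun_eq_iff)
    have 2: "(proj2 k i u)(i := 1) = (\<lambda>l. (1 / \<zeta> i) * \<zeta> l)"
      using pk i \<zeta>(1) by (auto simp: proj2_def u_def Cn_def fun_eq_iff)
    have "x = chart_point k i p u"
      unfolding chart_point_def 1 2 x bpoint_def
      using pline_scale[of "1 / z p" z] pline_scale[of "1 / \<zeta> i" \<zeta>] p i by simp
    moreover have "(i, p) \<in> charts m k" using i p pk by (simp add: charts_def)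
    ultimately show ?thesis using u by force
  qed
next
  fix x assume "x \<in> (\<Union>(i, j)\<in>charts m k. chart_point k i j ` Cn ({..m} - {j}))"
  then obtain i j u where ij: "(i, j) \<in> charts m k" and u: "u \<in> Cn ({..m} - {j})"
    and x: "x = chart_point k i j u" by auto
  let ?z = "(proj1 k i j u)(j := 1)" and ?\<zeta> = "(proj2 k i u)(i := 1)"
  have c: "1 * ?z l + (- ?z i) * ?\<zeta> l = 0" if "l \<le> k" for l
    using ij that by (auto simp: charts_def proj1_def proj2_def)
  have "?z \<in> Cn {..m}" "?\<zeta> \<in> Cn {..k}"
    using ij u assms by (auto simp: charts_def proj1_def proj2_def Cn_def)
  moreover have "?z \<noteq> (\<lambda>_. 0)" "?\<zeta> \<noteq> (\<lambda>_. 0)" by (auto simp: fun_eq_iff)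
  moreover have "\<exists>a b. (a \<noteq> 0 \<or> b \<noteq> 0) \<and> (\<forall>l\<le>k. a * ?z l + b * ?\<zeta> l = 0)"
    using c by (intro exI[of _ 1] exI[of _ "- ?z i"]) auto
  ultimately have "(?z, ?\<zeta>) \<in> homog_coords m k" by (auto simp: homog_coords_def)
  then show "x \<in> blowup m k" unfolding blowup_def x chart_point_def by force
qed

lemma dz_coord: "dz l (\<lambda>w. w a) u = (if a = l then 1 else 0)"
proof -
  have "vector_derivative (\<lambda>t::real. (u(l := u l + of_real t * d)) a) (at 0) = (if a = l then d else 0)" for d
  proof (cases "a = l")
    case True
    have "((\<lambda>t::real. u l + of_real t * d) has_vector_derivative d) (at 0)"
      by (auto intro!: derivative_eq_intros simp: has_vector_derivative_def scaleR_conv_of_real)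
    then show ?thesis using True by (simp add: vector_derivative_at)
  qed simp
  then show ?thesis by (simp add: dz_def rpart_def)
qed

lemma ddbar_cong_coords:
  assumes "\<And>w. f (F w) = f w" "\<And>w d. F (w(a := w a + d)) = (F w)(a := F w a + d)"
    "\<And>w d. F (w(b := w b + d)) = (F w)(b := F w b + d)"
  shows "ddbar a b f (F u) = ddbar a b f u"
proof -
  have f: "f ((F w)(b := F w b + d)) = f (w(b := w b + d))" for w d
    using assms by metis
  have 1: "dzbar b (\<lambda>u. of_real (f u)) (F w) = dzbar b (\<lambda>u. of_real (f u)) w" for w
    unfolding dzbar_def rpart_def f ..
  have 2: "dzbar b (\<lambda>u. of_real (f u)) ((F w)(a := F w a + d)) = dzbar b (\<lambda>u. of_real (f u)) (w(a := w a + d))" for w d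
    using 1 assms(2) by metis
  show ?thesis unfolding ddbar_def dz_def rpart_def 2 ..
qed

lemma ddbar_indep:
  assumes "(\<forall>w d. f (w(a := d)) = f w) \<or> (\<forall>w d. f (w(b := d)) = f w)"
  shows "ddbar a b f u = 0"
proof (cases "\<forall>w d. f (w(b := d)) = f w")
  case True
  then show ?thesis by (simp add: ddbar_def dz_def dzbar_def rpart_def)
next
  case False
  with assms have *: "f (w(a := d)) = f w" for w d by blast
  with False have "a \<noteq> b" by auto
  have 1: "f ((w(a := d))(b := e)) = f (w(b := e))" for w d e
    using *[of "w(b := e)" d] \<open>a \<noteq> b\<close> by (simp add: fun_upd_twist)
  have "dzbar b (\<lambda>u. of_real (f u)) (w(a := d)) = dzbar b (\<lambda>u. of_real (f u)) w" for w d
    unfolding dzbar_def rpart_def 1 using \<open>a \<noteq> b\<close> by simp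
  then show ?thesis unfolding ddbar_def dz_def rpart_def by simp
qed

lemma blowup_metric_dense_chart:
  assumes "k < m" "l \<in> {1..m}" "n \<in> {1..m}"
  shows "blowup_metric m k 0 0 l n u =
    of_nat (m + 1 - k) * ddbar l n (\<lambda>z. ln (1 + (\<Sum>i=1..m. (cmod (z i))\<^sup>2))) u +
    of_nat k * ddbar l n (\<lambda>z. ln (1 + (\<Sum>i=1..k. (cmod (z i))\<^sup>2))) u"
proof -
  have s: "{..r} - {0} = {1..r}" for r :: nat by auto
  have A: "pullback_form {1..m} (fubini_study m 0) (proj1 k 0 0) l n u = fubini_study m 0 l n u"
  proof -
    have *: "c * (if a = r then 1 else 0) = (if a = r then c else (0::complex))" for c and a r :: nat by simp
    show ?thesis using assms unfolding pullback_form_def proj1_def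
      by (simp add: dz_coord if_distrib[of cnj] * sum.delta cong: if_cong)
  qed
  let ?f = "\<lambda>z. ln (1 + (\<Sum>i=1..k. (cmod (z i))\<^sup>2))"
  have ind: "?f (w(r := d)) = ?f w" if "k < r" for r w d
    using that by (intro arg_cong[of _ _ ln] arg_cong[of _ _ "(+) 1"] sum.cong) auto
  have d2: "dz r (\<lambda>w. proj2 k 0 w a) u = (if a = r then 1 else 0)" if "a \<in> {1..k}" for a r
    using that by (simp add: proj2_def dz_coord)
  have "pullback_form {1..k} (fubini_study k 0) (proj2 k 0) l n u =
      (\<Sum>a=1..k. \<Sum>b=1..k. fubini_study k 0 a b (proj2 k 0 u) * (if a = l then 1 else 0) * (if b = n then 1 else 0))"
    unfolding pullback_form_def by (intro sum.cong refl) (simp add: d2 del: One_nat_def)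
  also have "\<dots> = (if l \<le> k \<and> n \<le> k then fubini_study k 0 l n (proj2 k 0 u) else 0)"
  proof -
    have *: "c * (if a = r then 1 else 0) = (if a = r then c else (0::complex))" for c and a r :: nat by simp
    show ?thesis using assms by (cases "n \<le> k") (simp_all add: * cong: if_cong)
  qed
  also have "\<dots> = ddbar l n ?f u"
  proof (cases "l \<le> k \<and> n \<le> k")
    case True
    have "ddbar l n ?f (proj2 k 0 u) = ddbar l n ?f u"
    proof (rule ddbar_cong_coords)
      show "?f (proj2 k 0 w) = ?f w" for w
        by (intro arg_cong[of _ _ ln] arg_cong[of _ _ "(+) 1"] sum.cong) (auto simp: proj2_def)
    qed (use True assms in \<open>auto simp: proj2_def fun_eq_iff\<close>)
    then show ?thesis using True by (simp add: fubini_study_def s)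
  next
    case False
    then have "k < l \<or> k < n" by auto
    then have "ddbar l n ?f u = 0"
      by (intro ddbar_indep) (use ind in blast)
    then show ?thesis using False by auto
  qed
  finally show ?thesis unfolding blowup_metric_def s A by (simp add: fubini_study_def s)
qed

end

theory Submission
  imports Defs
begin

text \<open>
  On the open torus orbit of the blow-up, a \<open>G\<close>-invariant function depends only on the numbers
  \<open>x\<^sub>l = ln |z\<^sub>l|\<^sup>2\<close>. With
  \<open>U(x) = (m+1-k) ln (\<Sum>l\<le>m. exp x\<^sub>l) + k ln (\<Sum>l\<le>k. exp x\<^sub>l) + \<phi>\<close>, the function \<open>U\<close> is convex:
  its second derivative along a line is a value of the Levi form of a local potential of the
  metric modified by \<open>\<phi>\<close>, which admissibility makes positive (\<open>second_deriv_log_curve\<close>, \<open>line_convex_potential\<close>).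

  Since \<open>\<phi> \<le> 0\<close>, the function \<open>U\<close> is bounded above by its two logarithmic terms, and these grow in a
  direction \<open>w\<close> with the slope \<open>(m+1-k) max\<^bsub>l\<le>m\<^esub> w\<^sub>l + k max\<^bsub>l\<le>k\<^esub> w\<^sub>l\<close>. A convex function cannot exceed
  its asymptotic slope, so \<open>U(y + w) - U(y)\<close> is at most this slope (\<open>line_convex_growth\<close>). Let \<open>y\<close>
  be equal to \<open>a\<close> on the indices up to \<open>k\<close> and to \<open>b\<close> on the others, and take \<open>w = x - y\<close>, where \<open>x\<close>
  comes from a torus point at which \<open>\<phi>\<close> is close to its supremum \<open>0\<close>. As \<open>max x\<^sub>l \<le> ln (\<Sum> exp x\<^sub>l)\<close>,
  the logarithmic terms of \<open>U(x)\<close> cancel, and \<open>U(y) \<ge> (m+1-k) min(a,b) + k a\<close> results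
  (\<open>potential_block_ge\<close>).

  Finally \<open>U\<close> is symmetric in each of the two blocks of indices, so replacing \<open>x\<close> by its averages
  \<open>a\<close> and \<open>b\<close> over the blocks does not increase \<open>U\<close> (\<open>line_convex_average\<close>). The resulting lower
  bound for \<open>U(x)\<close> is the inequality \<open>\<phi> \<ge> \<psi>\<close> where no coordinate vanishes (\<open>psi_eq\<close>); elsewhere
  \<open>\<psi> = -\<infinity>\<close>.
\<close>

section \<open>Differential calculus on coordinate spaces\<close>

lemma tendsto_coordinatewise:
  fixes g :: "'a \<Rightarrow> 'b \<Rightarrow> 'c::topological_space"
  assumes "\<And>l. ((\<lambda>s. g s l) \<longlongrightarrow> L l) F"
  shows "(g \<longlongrightarrow> L) F"
proof -
  have "limitin (product_topology (\<lambda>_. euclidean) UNIV) g L F"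
    using assms by (simp add: limitin_componentwise)
  then show ?thesis by (simp add: euclidean_product_topology)
qed

lemma Cn_upd: "u \<in> Cn I \<Longrightarrow> j \<in> I \<Longrightarrow> u(j := c) \<in> Cn I"
  by (auto simp: Cn_def)

lemma coord_line_has_deriv:
  fixes f :: "cvec \<Rightarrow> real"
  assumes "Ck_on_Cn I (Suc r) f" "j \<in> I" "d \<in> {1, \<i>}" "u \<in> Cn I"
  shows "((\<lambda>\<tau>. f (u(j := u j + of_real \<tau> * d))) has_real_derivative
           rpart d j f (u(j := u j + of_real \<tau> * d))) (at \<tau>)"
proof -
  let ?v = "u(j := u j + of_real \<tau> * d)"
  have "?v \<in> Cn I" using assms by (intro Cn_upd)
  then have "(\<lambda>t::real. f (?v(j := ?v j + of_real t * d))) differentiable (at 0)"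
    using assms(1)[unfolded Ck_on_Cn.simps] assms(2,3) by blast
  then have "((\<lambda>t::real. f (?v(j := ?v j + of_real t * d))) has_vector_derivative rpart d j f ?v) (at 0)"
    unfolding rpart_def by (simp add: vector_derivative_works)
  moreover have "(\<lambda>t::real. f (?v(j := ?v j + of_real t * d))) = (\<lambda>\<tau>. f (u(j := u j + of_real \<tau> * d))) \<circ> (\<lambda>t. \<tau> + t)"
    by (simp add: fun_eq_iff algebra_simps)
  ultimately have "((\<lambda>t. f (u(j := u j + of_real (t + \<tau>) * d))) has_real_derivative rpart d j f ?v) (at 0)"
    by (simp add: has_real_derivative_iff_has_vector_derivative o_def add.commute)
  then show ?thesis
    using DERIV_shift[of "\<lambda>\<tau>. f (u(j := u j + of_real \<tau> * d))" _ 0 \<tau>] by simp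
qed

lemma rpart_line:
  fixes f :: "cvec \<Rightarrow> real"
  assumes "Ck_on_Cn I (Suc r) f" "j \<in> I" "d \<in> {1, \<i>}" "u \<in> Cn I"
  shows "((\<lambda>t. f (u(j := u j + of_real t * d))) has_real_derivative rpart d j f u) (at 0)"
  using coord_line_has_deriv[OF assms, of 0] by simp

lemma Ck_rpart:
  assumes "Ck_on_Cn I (Suc r) f" "j \<in> I" "d \<in> {1, \<i>}"
  shows "Ck_on_Cn I r (rpart d j f)"
  using assms by auto

lemma Ck_continuous: "Ck_on_Cn I r f \<Longrightarrow> continuous_on (Cn I) f"
  by (cases r) auto

text \<open>
  Contribution of one real coordinate to the derivative along a curve. By the mean value theorem
  the increment is \<open>c s\<close> times a partial derivative at a nearby point, which converges by continuity
  of the partial derivative.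
\<close>
lemma chain_rule_step:
  fixes f :: "cvec \<Rightarrow> real" and w :: "real \<Rightarrow> cvec" and c :: "real \<Rightarrow> real"
  assumes f: "Ck_on_Cn I (Suc r) f" and j: "j \<in> I" and d: "d \<in> {1, \<i>}"
    and w: "\<And>s. w s \<in> Cn I" and wc: "\<And>l. isCont (\<lambda>s. w s l) t"
    and c: "(c has_real_derivative c') (at t)" and c0: "c t = 0"
  shows "((\<lambda>s. f ((w s)(j := w s j + of_real (c s) * d)) - f (w s)) has_real_derivative
           c' * rpart d j f (w t)) (at t)"
proof -
  let ?D = "\<lambda>s. f ((w s)(j := w s j + of_real (c s) * d)) - f (w s)"
  let ?p = "\<lambda>s \<xi>. (w s)(j := w s j + of_real \<xi> * d)"
  have "\<exists>\<xi>. \<bar>\<xi>\<bar> \<le> \<bar>c s\<bar> \<and> ?D s = c s * rpart d j f (?p s \<xi>)" for s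
  proof -
    let ?g = "\<lambda>\<tau>. f ((w s)(j := w s j + of_real \<tau> * d))"
    have D: "(?g has_real_derivative rpart d j f (?p s \<tau>)) (at \<tau>)" for \<tau>
      by (rule coord_line_has_deriv[OF f j d w])
    consider "c s = 0" | "0 < c s" | "c s < 0" by linarith
    then show ?thesis
    proof cases
      case 2
      then obtain \<xi> where "0 < \<xi>" "\<xi> < c s" "?g (c s) - ?g 0 = (c s - 0) * rpart d j f (?p s \<xi>)"
        using MVT2[of 0 "c s" ?g "\<lambda>\<tau>. rpart d j f (?p s \<tau>)"] D by blast
      then show ?thesis by (intro exI[of _ \<xi>]) simp
    next
      case 3
      then obtain \<xi> where "\<xi> < 0" "c s < \<xi>" "?g 0 - ?g (c s) = (0 - c s) * rpart d j f (?p s \<xi>)"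
        using MVT2[of "c s" 0 ?g "\<lambda>\<tau>. rpart d j f (?p s \<tau>)"] D by blast
      then show ?thesis by (intro exI[of _ \<xi>]) simp
    qed (auto intro!: exI[of _ 0])
  qed
  then obtain \<xi> where \<xi>: "\<And>s. \<bar>\<xi> s\<bar> \<le> \<bar>c s\<bar>" "\<And>s. ?D s = c s * rpart d j f (?p s (\<xi> s))" by metis
  have c_lim: "(c \<longlongrightarrow> 0) (at t)"
    using DERIV_isCont[OF c] c0 by (simp add: isCont_def)
  have \<xi>_lim: "(\<xi> \<longlongrightarrow> 0) (at t)"
    by (rule tendsto_rabs_zero_cancel, rule tendsto_sandwich[OF _ _ tendsto_const])
      (use \<xi>(1) tendsto_rabs_zero[OF c_lim] in auto)
  have p_lim: "((\<lambda>s. ?p s (\<xi> s)) \<longlongrightarrow> w t) (at t)"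
  proof (rule tendsto_coordinatewise)
    fix l
    have "((\<lambda>s. ?p s (\<xi> s) l) \<longlongrightarrow> ?p t 0 l) (at t)"
    proof (cases "l = j")
      case True
      have "((\<lambda>s. w s j + of_real (\<xi> s) * d) \<longlongrightarrow> w t j + of_real 0 * d) (at t)"
        by (intro tendsto_intros \<xi>_lim wc[unfolded isCont_def])
      then show ?thesis using True by simp
    qed (use wc[of l] in \<open>simp add: isCont_def\<close>)
    then show "((\<lambda>s. ?p s (\<xi> s) l) \<longlongrightarrow> w t l) (at t)" by simp
  qed
  have "continuous_on (Cn I) (rpart d j f)"
    using Ck_rpart[OF f j d] by (rule Ck_continuous)
  then have r_lim: "((\<lambda>s. rpart d j f (?p s (\<xi> s))) \<longlongrightarrow> rpart d j f (w t)) (at t)"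
    by (rule continuous_on_tendsto_compose[OF _ p_lim w]) (simp add: Cn_upd[OF w j])
  have "((\<lambda>s. (c s - c t) / (s - t)) \<longlongrightarrow> c') (at t)"
    using c by (simp add: has_field_derivative_iff)
  then have "((\<lambda>s. (c s - c t) / (s - t) * rpart d j f (?p s (\<xi> s))) \<longlongrightarrow> c' * rpart d j f (w t)) (at t)"
    using r_lim by (rule tendsto_mult)
  moreover have "(c s - c t) / (s - t) * rpart d j f (?p s (\<xi> s)) = (?D s - ?D t) / (s - t)" for s
    using \<xi>(2)[of s] c0 by simp
  ultimately show ?thesis unfolding has_field_derivative_iff by (simp only:)
qed

text \<open>
  The chain rule for continuous partial derivatives. The pairs \<open>(j, d)\<close> index the real coordinates;
  \<open>d \<bullet> c\<close> is the real part of \<open>c\<close> for \<open>d = 1\<close> and its imaginary part for \<open>d = \<i>\<close>.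
\<close>
lemma chain_rule_Cn:
  fixes f :: "cvec \<Rightarrow> real" and \<gamma> :: "real \<Rightarrow> cvec"
  assumes I: "finite I" and f: "Ck_on_Cn I (Suc r) f" and \<gamma>: "\<And>s. \<gamma> s \<in> Cn I"
    and d\<gamma>: "\<And>j. j \<in> I \<Longrightarrow> ((\<lambda>s. \<gamma> s j) has_vector_derivative \<gamma>' j) (at t)"
  shows "((\<lambda>s. f (\<gamma> s)) has_real_derivative
           (\<Sum>(j, d)\<in>I \<times> {1, \<i>}. (d \<bullet> \<gamma>' j) * rpart d j f (\<gamma> t))) (at t)"
proof -
  \<comment> \<open>\<open>w J\<close> follows \<open>\<gamma>\<close> in the real coordinates of \<open>J\<close> and stays at \<open>\<gamma> t\<close> in the others.\<close>
  define w where "w J s j = \<gamma> t j + (\<Sum>d | d \<in> {1, \<i>} \<and> (j, d) \<in> J. of_real (d \<bullet> (\<gamma> s j - \<gamma> t j)) * d)"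
    for J s j
  have wCn: "w J s \<in> Cn I" for J s
    using \<gamma>[of t] \<gamma>[of s] by (auto simp: w_def Cn_def)
  have cont: "isCont (\<lambda>s. \<gamma> s l) t" for l
  proof (cases "l \<in> I")
    case True
    then show ?thesis using d\<gamma> has_vector_derivative_continuous by blast
  next
    case False
    then have "(\<lambda>s. \<gamma> s l) = (\<lambda>s. 0)" using \<gamma> by (auto simp: Cn_def)
    then show ?thesis by simp
  qed
  have wcont: "isCont (\<lambda>s. w J s l) t" for J l
    unfolding w_def by (intro continuous_intros cont)
  have wt: "w J t = \<gamma> t" for J by (auto simp: w_def)
  have "((\<lambda>s. f (w J s)) has_real_derivative (\<Sum>(j, d)\<in>J. (d \<bullet> \<gamma>' j) * rpart d j f (\<gamma> t))) (at t)"
    if "finite J" "J \<subseteq> I \<times> {1, \<i>}" for J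
    using that
  proof (induction J)
    case empty
    then show ?case by (simp add: w_def)
  next
    case (insert q J)
    obtain j d where q: "q = (j, d)" by fastforce
    then have j: "j \<in> I" and d: "d \<in> {1, \<i>}" using insert.prems by auto
    let ?c = "\<lambda>s. d \<bullet> (\<gamma> s j - \<gamma> t j)"
    have c: "(?c has_real_derivative d \<bullet> \<gamma>' j) (at t)"
    proof -
      have "((\<lambda>s. \<gamma> s j - \<gamma> t j) has_vector_derivative \<gamma>' j) (at t)"
        using has_vector_derivative_diff[OF d\<gamma>[OF j] has_vector_derivative_const[of "\<gamma> t j"]] by simp
      from bounded_linear.has_vector_derivative[OF bounded_linear_inner_right this, of d]
      show ?thesis by (simp add: has_real_derivative_iff_has_vector_derivative)
    qed
    have step: "(w J s)(j := w J s j + of_real (?c s) * d) = w (insert q J) s" for s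
    proof
      fix l
      show "((w J s)(j := w J s j + of_real (?c s) * d)) l = w (insert q J) s l"
      proof (cases "l = j")
        case True
        have "{e. e \<in> {1, \<i>} \<and> (j, e) \<in> insert q J} = insert d {e. e \<in> {1, \<i>} \<and> (j, e) \<in> J}"
          using q d by auto
        moreover have "d \<notin> {e. e \<in> {1, \<i>} \<and> (j, e) \<in> J}" "finite {e. e \<in> {1, \<i>} \<and> (j, e) \<in> J}"
          using q insert.hyps by auto
        ultimately show ?thesis using True by (simp add: w_def)
      next
        case False
        then have "{e. e \<in> {1, \<i>} \<and> (l, e) \<in> insert q J} = {e. e \<in> {1, \<i>} \<and> (l, e) \<in> J}"
          using q by auto
        then show ?thesis using False by (simp add: w_def)
      qed
    qed
    have "((\<lambda>s. f (w (insert q J) s) - f (w J s)) has_real_derivative (d \<bullet> \<gamma>' j) * rpart d j f (\<gamma> t)) (at t)"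
      using chain_rule_step[OF f j d wCn[of J] wcont[of J] c] unfolding step wt by simp
    from DERIV_add[OF this insert.IH] insert show ?case by (simp add: q)
  qed
  from this[of "I \<times> {1, \<i>}"] I
  have "((\<lambda>s. f (w (I \<times> {1, \<i>}) s)) has_real_derivative
           (\<Sum>(j, d)\<in>I \<times> {1, \<i>}. (d \<bullet> \<gamma>' j) * rpart d j f (\<gamma> t))) (at t)" by blast
  moreover have "w (I \<times> {1, \<i>}) s = \<gamma> s" for s
  proof
    fix l
    show "w (I \<times> {1, \<i>}) s l = \<gamma> s l"
    proof (cases "l \<in> I")
      case True
      then have "{d. d \<in> {1, \<i>} \<and> (l, d) \<in> I \<times> {1, \<i>}} = {1, \<i>}" by auto
      then show ?thesis by (simp add: w_def complex_eq_iff inner_complex_def)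
    next
      case False
      then show ?thesis using \<gamma>[of s] \<gamma>[of t] by (simp add: w_def Cn_def)
    qed
  qed
  ultimately show ?thesis by simp
qed

lemma second_chain_rule_Cn:
  fixes f :: "cvec \<Rightarrow> real" and \<gamma> :: "real \<Rightarrow> cvec"
  assumes I: "finite I" and f: "Ck_on_Cn I (Suc (Suc r)) f" and \<gamma>: "\<And>s. \<gamma> s \<in> Cn I"
    and d\<gamma>: "\<And>j. j \<in> I \<Longrightarrow> ((\<lambda>s. \<gamma> s j) has_vector_derivative \<gamma>1 t j) (at t)"
    and dd\<gamma>: "\<And>j. j \<in> I \<Longrightarrow> ((\<lambda>s. \<gamma>1 s j) has_vector_derivative \<gamma>2 j) (at t)"
  shows "((\<lambda>s. \<Sum>(j, d)\<in>I \<times> {1, \<i>}. (d \<bullet> \<gamma>1 s j) * rpart d j f (\<gamma> s)) has_real_derivative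
           (\<Sum>(j, d)\<in>I \<times> {1, \<i>}. (d \<bullet> \<gamma>2 j) * rpart d j f (\<gamma> t) + (d \<bullet> \<gamma>1 t j) *
              (\<Sum>(l, e)\<in>I \<times> {1, \<i>}. (e \<bullet> \<gamma>1 t l) * rpart e l (rpart d j f) (\<gamma> t)))) (at t)"
proof (rule DERIV_sum, clarify)
  fix j :: nat and d :: complex assume j: "j \<in> I" and d: "d \<in> {1, \<i>}"
  have 1: "((\<lambda>s. d \<bullet> \<gamma>1 s j) has_real_derivative d \<bullet> \<gamma>2 j) (at t)"
    using bounded_linear.has_vector_derivative[OF bounded_linear_inner_right dd\<gamma>[OF j], of d]
    by (simp add: has_real_derivative_iff_has_vector_derivative)
  have 2: "((\<lambda>s. rpart d j f (\<gamma> s)) has_real_derivative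
     (\<Sum>(l, e)\<in>I \<times> {1, \<i>}. (e \<bullet> \<gamma>1 t l) * rpart e l (rpart d j f) (\<gamma> t))) (at t)"
    by (rule chain_rule_Cn[OF I Ck_rpart[OF f j d] \<gamma> d\<gamma>])
  show "((\<lambda>s. (d \<bullet> \<gamma>1 s j) * rpart d j f (\<gamma> s)) has_real_derivative
     (d \<bullet> \<gamma>2 j) * rpart d j f (\<gamma> t) + (d \<bullet> \<gamma>1 t j) *
       (\<Sum>(l, e)\<in>I \<times> {1, \<i>}. (e \<bullet> \<gamma>1 t l) * rpart e l (rpart d j f) (\<gamma> t))) (at t)"
    using DERIV_mult[OF 1 2] by (simp add: algebra_simps)
qed

lemma Re_ddbar:
  fixes f :: "cvec \<Rightarrow> real"
  assumes f: "Ck_on_Cn I (Suc (Suc r)) f" and a: "a \<in> I" and b: "b \<in> I" and u: "u \<in> Cn I"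
  shows "Re (ddbar a b f u) = (rpart 1 a (rpart 1 b f) u + rpart \<i> a (rpart \<i> b f) u) / 4"
proof -
  have cr: "rpart d b (\<lambda>u. of_real (f u) :: complex) w = of_real (rpart d b f w)"
    if "w \<in> Cn I" "d \<in> {1, \<i>}" for w d
    using bounded_linear.has_vector_derivative[OF bounded_linear_of_real[where 'a=complex]
        rpart_line[OF f b that(2,1), unfolded has_real_derivative_iff_has_vector_derivative]]
    unfolding rpart_def[of d b "\<lambda>u. of_real (f u) :: complex"] by (simp add: vector_derivative_at)
  let ?h = "\<lambda>w. (of_real (rpart 1 b f w) + \<i> * of_real (rpart \<i> b f w)) / (2::complex)"
  have h: "dzbar b (\<lambda>u. of_real (f u)) w = ?h w" if "w \<in> Cn I" for w
    using that by (simp add: dzbar_def cr)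
  have H: "rpart e a (dzbar b (\<lambda>u. of_real (f u))) u =
      (of_real (rpart e a (rpart 1 b f) u) + \<i> * of_real (rpart e a (rpart \<i> b f) u)) / 2"
    if e: "e \<in> {1, \<i>}" for e
  proof -
    have D: "((\<lambda>t. of_real (rpart d b f (u(a := u a + of_real t * e)))) has_vector_derivative
        (of_real (rpart e a (rpart d b f) u) :: complex)) (at 0)" if "d \<in> {1, \<i>}" for d
      using bounded_linear.has_vector_derivative[OF bounded_linear_of_real[where 'a=complex]
        rpart_line[OF Ck_rpart[OF f b that] a e u, unfolded has_real_derivative_iff_has_vector_derivative]]
      by simp
    have "((\<lambda>t. ?h (u(a := u a + of_real t * e))) has_vector_derivative
      (of_real (rpart e a (rpart 1 b f) u) + \<i> * of_real (rpart e a (rpart \<i> b f) u)) / 2) (at 0)"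
      using D[of 1] D[of \<i>]
      by (intro has_vector_derivative_divide has_vector_derivative_add has_vector_derivative_mult_right) auto
    then show ?thesis
      unfolding rpart_def[of e a "dzbar b (\<lambda>u. of_real (f u))"] h[OF Cn_upd[OF u a]]
      by (rule vector_derivative_at)
  qed
  show ?thesis unfolding ddbar_def dz_def by (simp add: H)
qed

text \<open>
  For a function that depends only on the moduli of the coordinates, the second derivative along
  a curve that is a line in the coordinates \<open>ln |u\<^sub>l|\<close> is a value of the Levi form: the
  derivatives in the imaginary directions that the Levi form contains in addition are found by
  differentiating twice along the corresponding curve of rotations, on which the function is
  constant.
\<close>
lemma second_deriv_log_curve:
  fixes f :: "cvec \<Rightarrow> real" and x y :: "nat \<Rightarrow> real"
  assumes I: "finite I" and f: "Ck_on_Cn I (Suc (Suc r)) f"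
    and inv: "\<And>u e. u \<in> Cn I \<Longrightarrow> (\<And>l. cmod (e l) = 1) \<Longrightarrow> f (\<lambda>l. e l * u l) = f u"
  defines "\<gamma> \<equiv> \<lambda>t l. if l \<in> I then complex_of_real (exp ((x l + t * y l) / 2)) else 0"
  obtains g where "\<And>t. ((\<lambda>t. f (\<gamma> t)) has_real_derivative g t) (at t)"
    "\<And>t. (g has_real_derivative
        Re (\<Sum>a\<in>I. \<Sum>b\<in>I. ddbar a b f (\<gamma> t) * (of_real (y a) * \<gamma> t a) * cnj (of_real (y b) * \<gamma> t b))) (at t)"
proof -
  define \<gamma>1 \<gamma>2 where "\<gamma>1 = (\<lambda>t l. complex_of_real (y l / 2) * \<gamma> t l)"
    and "\<gamma>2 = (\<lambda>t l. complex_of_real ((y l / 2)\<^sup>2) * \<gamma> t l)"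
  have \<gamma>Cn: "\<gamma> t \<in> Cn I" for t by (simp add: \<gamma>_def Cn_def)
  have d\<gamma>: "((\<lambda>s. \<gamma> s j) has_vector_derivative \<gamma>1 t j) (at t)" if "j \<in> I" for j t
  proof -
    have "((\<lambda>t. exp ((x j + t * y j) / 2)) has_vector_derivative exp ((x j + t * y j) / 2) * (y j / 2)) (at t)"
      unfolding has_real_derivative_iff_has_vector_derivative[symmetric]
      by (auto intro!: derivative_eq_intros)
    from bounded_linear.has_vector_derivative[OF bounded_linear_of_real[where 'a=complex] this]
    show ?thesis using that by (simp add: \<gamma>_def \<gamma>1_def mult.commute)
  qed
  have dd\<gamma>: "((\<lambda>s. \<gamma>1 s j) has_vector_derivative \<gamma>2 t j) (at t)" if "j \<in> I" for j t
    using has_vector_derivative_mult_right[OF d\<gamma>[OF that], where a="complex_of_real (y j / 2)"]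
    by (simp add: \<gamma>1_def \<gamma>2_def power2_eq_square mult.assoc)
  define g where "g = (\<lambda>s. \<Sum>(j, d)\<in>I \<times> {1, \<i>}. (d \<bullet> \<gamma>1 s j) * rpart d j f (\<gamma> s))"
  have g1: "((\<lambda>t. f (\<gamma> t)) has_real_derivative g t) (at t)" for t
    unfolding g_def by (rule chain_rule_Cn[OF I f \<gamma>Cn d\<gamma>])
  define v where "v = (\<lambda>t l. y l * exp ((x l + t * y l) / 2))"
  have expand: "(\<Sum>(j, d)\<in>I \<times> {1, \<i>}. F j d) = (\<Sum>j\<in>I. F j 1 + F j \<i>)" for F :: "nat \<Rightarrow> complex \<Rightarrow> real"
    by (simp add: sum.cartesian_product[symmetric])
  have \<gamma>1: "\<gamma>1 t l = of_real (v t l / 2)" if "l \<in> I" for t l using that by (simp add: \<gamma>1_def v_def \<gamma>_def)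
  have \<gamma>2: "\<gamma>2 t l = of_real (y l * v t l / 4)" if "l \<in> I" for t l
    using that by (simp add: \<gamma>2_def v_def \<gamma>_def power2_eq_square)
  let ?A = "\<lambda>t. \<Sum>j\<in>I. y j * v t j / 4 * rpart 1 j f (\<gamma> t)"
  let ?B = "\<lambda>d t. \<Sum>j\<in>I. \<Sum>l\<in>I. v t j / 2 * (v t l / 2) * rpart d l (rpart d j f) (\<gamma> t)"
  have g2: "(g has_real_derivative ?A t + ?B 1 t) (at t)" for t
  proof -
    have "(\<Sum>(j, d)\<in>I \<times> {1, \<i>}. (d \<bullet> \<gamma>2 t j) * rpart d j f (\<gamma> t) + (d \<bullet> \<gamma>1 t j) *
              (\<Sum>(l, e)\<in>I \<times> {1, \<i>}. (e \<bullet> \<gamma>1 t l) * rpart e l (rpart d j f) (\<gamma> t))) = ?A t + ?B 1 t"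
      unfolding expand sum.distrib[symmetric]
      by (intro sum.cong refl) (simp add: \<gamma>1 \<gamma>2 inner_complex_def sum_distrib_left mult.assoc)
    then show ?thesis
      using second_chain_rule_Cn[OF I f \<gamma>Cn d\<gamma> dd\<gamma>, of t] by (simp add: g_def)
  qed
  \<comment> \<open>Differentiating twice along the rotations \<open>s \<mapsto> cis (y\<^sub>l s / 2) \<gamma>\<^sub>l(t)\<close>, where \<open>f\<close> is constant.\<close>
  have rot: "?A t = ?B \<i> t" for t
  proof -
    define \<rho> where "\<rho> = (\<lambda>c s l. c l * cis (y l / 2 * s) * \<gamma> t l)"
    have \<rho>Cn: "\<rho> c s \<in> Cn I" for c s using \<gamma>Cn[of t] by (simp add: \<rho>_def Cn_def)
    have dcis: "((\<lambda>s. cis (y j / 2 * s)) has_vector_derivative \<i> * of_real (y j / 2) * cis (y j / 2 * s)) (at s)" for s j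
    proof -
      have *: "((\<lambda>s. y j / 2 * s) has_real_derivative y j / 2) (at s)" by (auto intro!: derivative_eq_intros)
      show ?thesis
        using has_derivative_cis[OF *[unfolded has_field_derivative_def]]
        by (simp add: has_vector_derivative_def scaleR_conv_of_real mult_ac)
    qed
    have d\<rho>: "((\<lambda>s. \<rho> c s j) has_vector_derivative \<rho> c' s j) (at s)"
      if "c' = (\<lambda>l. c l * (\<i> * of_real (y l / 2)))" for c c' s j
      using has_vector_derivative_mult_right[OF dcis[of j s], where a="c j * \<gamma> t j"]
      by (simp add: \<rho>_def that mult_ac)
    define c1 c2 where "c1 = (\<lambda>l. \<i> * complex_of_real (y l / 2))" and "c2 = (\<lambda>l. c1 l * (\<i> * of_real (y l / 2)))"
    have c1: "c1 = (\<lambda>l. 1 * (\<i> * of_real (y l / 2)))" by (simp add: c1_def)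
    let ?q = "\<rho> (\<lambda>_. 1)" and ?q1 = "\<rho> c1" and ?q2 = "\<rho> c2"
    have const: "f (?q s) = f (\<gamma> t)" for s
      using inv[OF \<gamma>Cn, of "\<lambda>l. cis (y l / 2 * s)" t] by (simp add: \<rho>_def)
    define G where "G = (\<lambda>s. \<Sum>(j, d)\<in>I \<times> {1, \<i>}. (d \<bullet> ?q1 s j) * rpart d j f (?q s))"
    have "((\<lambda>s. f (?q s)) has_real_derivative G s) (at s)" for s
      unfolding G_def by (rule chain_rule_Cn[OF I f \<rho>Cn d\<rho>[OF c1]])
    then have G0: "G = (\<lambda>s. 0)" unfolding const using DERIV_unique[OF _ DERIV_const] by blast
    have "(G has_real_derivative (\<Sum>(j, d)\<in>I \<times> {1, \<i>}. (d \<bullet> ?q2 0 j) * rpart d j f (?q 0) + (d \<bullet> ?q1 0 j) *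
              (\<Sum>(l, e)\<in>I \<times> {1, \<i>}. (e \<bullet> ?q1 0 l) * rpart e l (rpart d j f) (?q 0)))) (at 0)" (is "(_ has_real_derivative ?S) _")
      unfolding G_def by (rule second_chain_rule_Cn[OF I f \<rho>Cn d\<rho>[OF c1] d\<rho>[OF c2_def]])
    then have "?S = 0" unfolding G0 using DERIV_unique[OF _ DERIV_const] by blast
    moreover have "?S = - ?A t + ?B \<i> t"
    proof -
      have q: "?q 0 = \<gamma> t" by (simp add: \<rho>_def)
      have q1: "?q1 0 l = \<i> * of_real (v t l / 2)" if "l \<in> I" for l
        using that by (simp add: \<rho>_def v_def \<gamma>_def c1_def)
      have q2: "?q2 0 l = - of_real (y l * v t l / 4)" if "l \<in> I" for l
        using that by (simp add: \<rho>_def v_def \<gamma>_def c1_def c2_def complex_eq_iff)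
      show ?thesis unfolding expand q sum_negf[symmetric] sum.distrib[symmetric]
        by (intro sum.cong refl) (simp add: q1 q2 inner_complex_def sum_distrib_left mult.assoc)
    qed
    ultimately show ?thesis by simp
  qed
  have levi: "?A t + ?B 1 t = Re (\<Sum>a\<in>I. \<Sum>b\<in>I. ddbar a b f (\<gamma> t) * (of_real (y a) * \<gamma> t a) * cnj (of_real (y b) * \<gamma> t b))" for t
  proof -
    have "Re (ddbar a b f (\<gamma> t) * (of_real (y a) * \<gamma> t a) * cnj (of_real (y b) * \<gamma> t b)) =
       v t b / 2 * (v t a / 2) * rpart \<i> a (rpart \<i> b f) (\<gamma> t) + v t b / 2 * (v t a / 2) * rpart 1 a (rpart 1 b f) (\<gamma> t)"
      if "a \<in> I" "b \<in> I" for a b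
    proof -
      have 1: "of_real (y l) * \<gamma> t l = of_real (v t l)" if "l \<in> I" for l
        using that by (simp add: v_def \<gamma>_def)
      show ?thesis unfolding 1[OF that(1)] 1[OF that(2)]
        by (simp add: Re_ddbar[OF f that \<gamma>Cn] field_simps)
    qed
    then have "Re (\<Sum>a\<in>I. \<Sum>b\<in>I. ddbar a b f (\<gamma> t) * (of_real (y a) * \<gamma> t a) * cnj (of_real (y b) * \<gamma> t b)) =
      (\<Sum>a\<in>I. \<Sum>b\<in>I. v t b / 2 * (v t a / 2) * rpart \<i> a (rpart \<i> b f) (\<gamma> t) + v t b / 2 * (v t a / 2) * rpart 1 a (rpart 1 b f) (\<gamma> t))"
      by (simp cong: sum.cong)
    also have "\<dots> = ?B \<i> t + ?B 1 t"
      by (subst sum.swap) (simp add: sum.distrib)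
    finally show ?thesis using rot by simp
  qed
  show ?thesis by (rule that[OF g1 g2[unfolded levi]])
qed

section \<open>Convexity of the potential in the dense chart\<close>

lemma continuous_on_coord [continuous_intros]: "continuous_on A (\<lambda>u::cvec. u l)"
  by (intro continuous_on_subset[OF continuous_on_product_coordinates] subset_UNIV)

text \<open>The local potentials of the Fubini--Study metrics.\<close>
lemma Ck_fubini_study_potential:
  assumes J: "finite J"
  shows "Ck_on_Cn I (Suc (Suc 0)) (\<lambda>u. ln (1 + (\<Sum>l\<in>J. (cmod (u l))\<^sup>2)))"
proof -
  define S where "S = (\<lambda>u::cvec. 1 + (\<Sum>l\<in>J. (cmod (u l))\<^sup>2))"
  define q where "q = (\<lambda>d j (u::cvec). if j \<in> J then 2 * (d \<bullet> u j) else 0)"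
  define q' where "q' = (\<lambda>d j (e::complex) a. if j \<in> J \<and> a = j then 2 * (d \<bullet> e) else (0::real))"
  have S_pos: "S u > 0" for u unfolding S_def by (intro add_pos_nonneg sum_nonneg) auto
  then have S_ne: "S u \<noteq> 0" for u by (metis less_irrefl)
  have dS: "((\<lambda>t. S (u(j := u j + of_real t * d))) has_real_derivative q d j u) (at 0)"
    for u j d
  proof -
    have "((\<lambda>t. (cmod ((u(j := u j + of_real t * d)) l))\<^sup>2) has_real_derivative
        (if l = j then 2 * (d \<bullet> u j) else 0)) (at 0)" for l
      by (auto simp: cmod_power2 inner_complex_def intro!: derivative_eq_intros)
    then have "((\<lambda>t. S (u(j := u j + of_real t * d))) has_real_derivative
        0 + (\<Sum>l\<in>J. if l = j then 2 * (d \<bullet> u j) else 0)) (at 0)"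
      unfolding S_def by (intro DERIV_add DERIV_const DERIV_sum)
    then show ?thesis using J by (simp add: q_def)
  qed
  have dq: "((\<lambda>t. q d j (u(a := u a + of_real t * e))) has_real_derivative q' d j e a) (at 0)"
    for d j u e a
    unfolding q_def q'_def
    by (cases "j \<in> J"; cases "a = j") (auto simp: inner_complex_def intro!: derivative_eq_intros)
  have D1: "((\<lambda>t. ln (S (u(j := u j + of_real t * d)))) has_real_derivative q d j u / S u) (at 0)"
    for u j d
    using DERIV_ln_divide[of "S u"] S_pos[of u] DERIV_chain2[of ln "inverse (S u)" "\<lambda>t. S (u(j := u j + of_real t * d))" 0, OF _ dS]
    by (simp add: divide_inverse mult.commute)
  have D2: "((\<lambda>t. q d j (u(a := u a + of_real t * e)) / S (u(a := u a + of_real t * e))) has_real_derivative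
      (q' d j e a * S u - q d j u * q e a u) / (S u * S u)) (at 0)"
    for u j d e a
    using DERIV_divide[OF dq[of d j u a e] dS[of u a e]] S_ne[of u] by simp
  have r1: "rpart d j (\<lambda>u. ln (S u)) = (\<lambda>u. q d j u / S u)" for d j
    unfolding rpart_def using D1[unfolded has_real_derivative_iff_has_vector_derivative]
    by (auto intro!: vector_derivative_at)
  have r2: "rpart e a (\<lambda>u. q d j u / S u) = (\<lambda>u. (q' d j e a * S u - q d j u * q e a u) / (S u * S u))" for d j e a
    unfolding rpart_def using D2[unfolded has_real_derivative_iff_has_vector_derivative]
    by (auto intro!: vector_derivative_at)
  have cS: "continuous_on A S" for A unfolding S_def by (intro continuous_intros)
  have cq: "continuous_on A (q d j)" for A d j
    unfolding q_def by (cases "j \<in> J") (auto intro!: continuous_intros)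
  have "Ck_on_Cn I (Suc (Suc 0)) (\<lambda>u. ln (S u))"
    unfolding Ck_on_Cn.simps r1 r2
    by (intro conjI ballI continuous_intros cS cq
        differentiableI_vector[OF D1[unfolded has_real_derivative_iff_has_vector_derivative]]
        differentiableI_vector[OF D2[unfolded has_real_derivative_iff_has_vector_derivative]])
      (simp_all add: S_ne)
  then show ?thesis by (simp add: S_def)
qed

text \<open>
  In the dense chart, the potential of the metric with \<open>\<phi>\<close> added is convex in the logarithms of
  the moduli of the coordinates.
\<close>
lemma convex_potential_dense_chart:
  fixes \<phi> :: "cvec set \<times> cvec set \<Rightarrow> real" and x y :: "nat \<Rightarrow> real"
  assumes km: "k < m" and sm: "smooth_on_blowup m k \<phi>" and adm: "admissible m k \<phi>"
    and inv: "\<And>u e. u \<in> Cn {1..m} \<Longrightarrow> (\<And>l. cmod (e l) = 1) \<Longrightarrow>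
      \<phi> (chart_point k 0 0 (\<lambda>l. e l * u l)) = \<phi> (chart_point k 0 0 u)"
  defines "\<gamma> \<equiv> \<lambda>t l. if l \<in> {1..m} then complex_of_real (exp ((x l + t * y l) / 2)) else 0"
  shows "convex_on UNIV (\<lambda>t. real (m + 1 - k) * ln (1 + (\<Sum>l=1..m. (cmod (\<gamma> t l))\<^sup>2)) +
    real k * ln (1 + (\<Sum>l=1..k. (cmod (\<gamma> t l))\<^sup>2)) + \<phi> (chart_point k 0 0 (\<gamma> t)))"
proof -
  have I: "{..m} - {0} = {1..m}" by auto
  have ch: "(0, 0) \<in> charts m k" by (simp add: charts_def)
  let ?f1 = "\<lambda>u::cvec. ln (1 + (\<Sum>l=1..m. (cmod (u l))\<^sup>2))"
  let ?f2 = "\<lambda>u::cvec. ln (1 + (\<Sum>l=1..k. (cmod (u l))\<^sup>2))"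
  let ?f3 = "\<lambda>u. \<phi> (chart_point k 0 0 u)"
  let ?L = "\<lambda>f t. Re (\<Sum>a\<in>{1..m}. \<Sum>b\<in>{1..m}. ddbar a b f (\<gamma> t) * (of_real (y a) * \<gamma> t a) * cnj (of_real (y b) * \<gamma> t b))"
  have C3: "Ck_on_Cn {1..m} (Suc (Suc 0)) ?f3"
  proof -
    have "smooth_on_Cn ({..m} - {0}) ?f3"
      using bspec[OF sm[unfolded smooth_on_blowup_def] ch] by simp
    then show ?thesis unfolding smooth_on_Cn_def I by blast
  qed
  obtain g1 where g1: "\<And>t. ((\<lambda>t. ?f1 (\<gamma> t)) has_real_derivative g1 t) (at t)"
      "\<And>t. (g1 has_real_derivative ?L ?f1 t) (at t)"
    using second_deriv_log_curve[OF finite_atLeastAtMost Ck_fubini_study_potential[OF finite_atLeastAtMost], of 1 m 1 m x y]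
    unfolding \<gamma>_def by (auto simp: norm_mult)
  obtain g2 where g2: "\<And>t. ((\<lambda>t. ?f2 (\<gamma> t)) has_real_derivative g2 t) (at t)"
      "\<And>t. (g2 has_real_derivative ?L ?f2 t) (at t)"
    using second_deriv_log_curve[OF finite_atLeastAtMost Ck_fubini_study_potential[OF finite_atLeastAtMost], of 1 m 1 k x y]
    unfolding \<gamma>_def by (auto simp: norm_mult)
  obtain g3 where g3: "\<And>t. ((\<lambda>t. ?f3 (\<gamma> t)) has_real_derivative g3 t) (at t)"
      "\<And>t. (g3 has_real_derivative ?L ?f3 t) (at t)"
    using second_deriv_log_curve[OF finite_atLeastAtMost C3, of x y] inv
    unfolding \<gamma>_def by blast
  have pos: "real (m + 1 - k) * ?L ?f1 t + real k * ?L ?f2 t + ?L ?f3 t \<ge> 0" for t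
  proof -
    have Re_comb: "Re (of_nat a * p + of_nat b * q + r) = real a * Re p + real b * Re q + Re r"
      for a b p q r by simp
    let ?H = "\<lambda>a b. blowup_metric m k 0 0 a b (\<gamma> t) + ddbar a b ?f3 (\<gamma> t)"
    have \<gamma>Cn: "\<gamma> t \<in> Cn ({..m} - {0})" by (simp add: \<gamma>_def Cn_def)
    have H: "pos_def_hermitian {1..m} ?H"
      using adm ch \<gamma>Cn unfolding admissible_def I[symmetric] by blast
    let ?v = "\<lambda>a. of_real (y a) * \<gamma> t a"
    have "0 \<le> Re (\<Sum>a\<in>{1..m}. \<Sum>b\<in>{1..m}. ?H a b * ?v a * cnj (?v b))"
    proof (cases "\<exists>a\<in>{1..m}. ?v a \<noteq> 0")
      case True
      then have "0 < Re (\<Sum>a\<in>{1..m}. \<Sum>b\<in>{1..m}. ?H a b * ?v a * cnj (?v b))"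
        using H[unfolded pos_def_hermitian_def, THEN conjunct2, THEN spec[of _ ?v]] by simp
      then show ?thesis by linarith
    next
      case False
      then have "(\<Sum>a\<in>{1..m}. \<Sum>b\<in>{1..m}. ?H a b * ?v a * cnj (?v b)) = 0"
        by (intro sum.neutral ballI) auto
      then show ?thesis by simp
    qed
    also have "(\<Sum>a\<in>{1..m}. \<Sum>b\<in>{1..m}. ?H a b * ?v a * cnj (?v b)) =
      (\<Sum>a\<in>{1..m}. \<Sum>b\<in>{1..m}. of_nat (m + 1 - k) * (ddbar a b ?f1 (\<gamma> t) * ?v a * cnj (?v b)) +
        of_nat k * (ddbar a b ?f2 (\<gamma> t) * ?v a * cnj (?v b)) + ddbar a b ?f3 (\<gamma> t) * ?v a * cnj (?v b))"
      by (intro sum.cong refl, subst blowup_metric_dense_chart[OF km]) (simp_all add: algebra_simps)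
    also have "Re \<dots> = real (m + 1 - k) * ?L ?f1 t + real k * ?L ?f2 t + ?L ?f3 t"
      by (simp only: sum.distrib sum_distrib_left[symmetric] Re_comb)
    finally show ?thesis .
  qed
  show ?thesis
  proof (rule f''_ge0_imp_convex[OF convex_UNIV])
    show "((\<lambda>t. real (m + 1 - k) * ?f1 (\<gamma> t) + real k * ?f2 (\<gamma> t) + ?f3 (\<gamma> t)) has_real_derivative
      real (m + 1 - k) * g1 t + real k * g2 t + g3 t) (at t)" for t
      by (intro DERIV_add DERIV_cmult g1 g2 g3)
    show "((\<lambda>t. real (m + 1 - k) * g1 t + real k * g2 t + g3 t) has_real_derivative
      real (m + 1 - k) * ?L ?f1 t + real k * ?L ?f2 t + ?L ?f3 t) (at t)" for t
      by (intro DERIV_add DERIV_cmult g1 g2 g3)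
  qed (rule pos)
qed

section \<open>Functions convex along lines\<close>

text \<open>
  Convexity of a function of infinitely many real variables, stated on each line, so that no vector
  space structure on \<open>nat \<Rightarrow> real\<close> is needed.
\<close>
definition line_convex :: "((nat \<Rightarrow> real) \<Rightarrow> real) \<Rightarrow> bool" where
  "line_convex U \<longleftrightarrow> (\<forall>x y. convex_on UNIV (\<lambda>t. U (\<lambda>l. x l + t * y l)))"

lemma line_convex_Jensen:
  assumes U: "line_convex U" and S: "finite S" "S \<noteq> {}"
  shows "U (\<lambda>i. (\<Sum>s\<in>S. X s i) / card S) \<le> (\<Sum>s\<in>S. U (X s)) / card S"
  using S
proof (induction S rule: finite_ne_induct)
  case (singleton s)
  then show ?case by simp
next
  case (insert s S)
  define n where "n = real (card S)"
  have n: "n > 0" using insert.hyps by (simp add: n_def card_gt_0_iff)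
  have c: "real (card (insert s S)) = n + 1" using insert.hyps by (simp add: n_def)
  let ?a = "\<lambda>i. (\<Sum>s\<in>S. X s i) / n" and ?t = "1 / (n + 1)"
  have avg: "(1 - ?t) * (T / n) + ?t * b = (b + T) / (n + 1)" for T b :: real
  proof -
    have "1 - ?t = n / (n + 1)" using n by (simp add: field_simps)
    then show ?thesis using n by (simp add: add_divide_distrib)
  qed
  let ?h = "\<lambda>t. U (\<lambda>i. ?a i + t * (X s i - ?a i))"
  have "convex_on UNIV ?h" using U by (simp add: line_convex_def)
  from convex_onD[OF this, of ?t 0 1] n
  have "?h ?t \<le> (1 - ?t) * ?h 0 + ?t * ?h 1" by simp
  also have "?h 0 = U ?a" by simp
  also have "?h 1 = U (X s)" by simp
  also have "(1 - ?t) * U ?a \<le> (1 - ?t) * ((\<Sum>s\<in>S. U (X s)) / n)"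
    using n insert.IH by (intro mult_left_mono) (auto simp: n_def)
  also have "(1 - ?t) * ((\<Sum>s\<in>S. U (X s)) / n) + ?t * U (X s) = (\<Sum>s\<in>insert s S. U (X s)) / (n + 1)"
    using insert.hyps avg[of "\<Sum>s\<in>S. U (X s)" "U (X s)"] by simp
  also have "(\<lambda>i. ?a i + ?t * (X s i - ?a i)) = (\<lambda>i. (\<Sum>s\<in>insert s S. X s i) / (n + 1))"
  proof
    fix i
    have "a + r * (b - a) = (1 - r) * a + r * b" for a b r :: real by (simp add: algebra_simps)
    then show "?a i + ?t * (X s i - ?a i) = (\<Sum>s\<in>insert s S. X s i) / (n + 1)"
      using insert.hyps by (simp only: avg sum.insert not_False_eq_True)
  qed
  finally show ?case unfolding c by simp
qed

text \<open>
  Averaging over a block of coordinates does not increase a symmetric convex function. A new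
  coordinate \<open>a\<close> enters the average by Jensen's inequality for the vectors obtained from the one
  already averaged over \<open>A\<close> by exchanging \<open>a\<close> with each element of \<open>insert a A\<close>.
\<close>
lemma line_convex_average:
  assumes U: "line_convex U" and A: "finite A" "A \<noteq> {}"
    and sym: "\<And>x i j. i \<in> A \<Longrightarrow> j \<in> A \<Longrightarrow> U (x \<circ> Transposition.transpose i j) = U x"
  shows "U (\<lambda>i. if i \<in> A then (\<Sum>s\<in>A. x s) / card A else x i) \<le> U x"
  using A sym
proof (induction A rule: finite_ne_induct)
  case (singleton a)
  have "(\<lambda>i. if i \<in> {a} then (\<Sum>s\<in>{a}. x s) / card {a} else x i) = x" by auto
  then show ?case by simp
next
  case (insert a A)
  define n where "n = real (card A)"
  have n: "n > 0" using insert.hyps by (simp add: n_def card_gt_0_iff)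
  have c: "real (card (insert a A)) = n + 1" using insert.hyps by (simp add: n_def)
  define c where "c = (\<Sum>s\<in>A. x s) / n"
  define x' where "x' = (\<lambda>i. if i \<in> A then c else x i)"
  have IH: "U x' \<le> U x" using insert.IH insert.prems unfolding x'_def c_def n_def by blast
  have sum_x': "(\<Sum>s\<in>insert a A. x' (Transposition.transpose a s i)) =
      (if i \<in> insert a A then \<Sum>s\<in>insert a A. x s else (n + 1) * x i)" for i
  proof -
    consider "i = a" | "i \<in> A" "i \<noteq> a" | "i \<notin> insert a A" by blast
    then show ?thesis
    proof cases
      case 1
      have "(\<Sum>s\<in>insert a A. x' s) = x a + (\<Sum>s\<in>A. c)"
        using insert.hyps by (simp add: x'_def)
      then show ?thesis using 1 insert.hyps n by (simp add: c_def n_def)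
    next
      case 2
      have "(\<Sum>s\<in>insert a A. x' (Transposition.transpose a s i)) = (\<Sum>s\<in>insert a A. if s = i then x a else c)"
        using 2 insert.hyps by (intro sum.cong refl) (auto simp: Transposition.transpose_def x'_def)
      also have "\<dots> = x a + (\<Sum>s\<in>insert a A - {i}. c)"
        using 2 insert.hyps by (subst sum.remove[of _ i]) (auto intro!: sum.cong)
      also have "(\<Sum>s\<in>insert a A - {i}. c) = n * c"
        using 2 insert.hyps by (simp add: n_def)
      finally show ?thesis using 2 insert.hyps n by (simp add: c_def)
    next
      case 3
      then have "(\<Sum>s\<in>insert a A. x' (Transposition.transpose a s i)) = (\<Sum>s\<in>insert a A. x i)"
        by (intro sum.cong refl) (auto simp: Transposition.transpose_def x'_def)
      then show ?thesis using 3 c by simp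
    qed
  qed
  have "U (\<lambda>i. (\<Sum>s\<in>insert a A. (x' \<circ> Transposition.transpose a s) i) / card (insert a A)) \<le>
      (\<Sum>s\<in>insert a A. U (x' \<circ> Transposition.transpose a s)) / card (insert a A)"
    using insert.hyps by (intro line_convex_Jensen[OF U]) auto
  also have "(\<Sum>s\<in>insert a A. U (x' \<circ> Transposition.transpose a s)) = (\<Sum>s\<in>insert a A. U x')"
    by (intro sum.cong refl insert.prems) auto
  also have "(\<Sum>s\<in>insert a A. U x') / card (insert a A) = U x'"
    using n c by (simp del: card_insert_disjoint)
  also have "(\<lambda>i. (\<Sum>s\<in>insert a A. (x' \<circ> Transposition.transpose a s) i) / card (insert a A)) =
      (\<lambda>i. if i \<in> insert a A then (\<Sum>s\<in>insert a A. x s) / card (insert a A) else x i)"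
    unfolding c o_def sum_x' using n by (auto simp: fun_eq_iff)
  finally show ?case using IH by linarith
qed

text \<open>
  The slope of \<open>h\<close> between \<open>0\<close> and \<open>1\<close> is at most the one between \<open>0\<close> and \<open>t \<ge> 1\<close>; the limit
  \<open>t \<rightarrow> \<infinity>\<close> of the latter is at most \<open>D\<close>.
\<close>
lemma convex_le_asymptotic_slope:
  fixes h :: "real \<Rightarrow> real"
  assumes h: "convex_on UNIV h" and le: "\<And>t. t \<ge> 1 \<Longrightarrow> h t \<le> C + t * D"
  shows "h 1 \<le> h 0 + D"
proof (rule ccontr)
  assume "\<not> ?thesis"
  then have e: "h 1 - h 0 - D > 0" by simp
  obtain t where t: "t \<ge> 1" "t * (h 1 - h 0 - D) > C - h 0"
  proof
    let ?t = "max 1 ((C - h 0 + 1) / (h 1 - h 0 - D))"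
    show "?t \<ge> 1" by simp
    have "C - h 0 < (C - h 0 + 1) / (h 1 - h 0 - D) * (h 1 - h 0 - D)" using e by simp
    also have "\<dots> \<le> ?t * (h 1 - h 0 - D)" using e by (intro mult_right_mono) auto
    finally show "?t * (h 1 - h 0 - D) > C - h 0" .
  qed
  have "h 1 \<le> (1 - 1 / t) * h 0 + 1 / t * h t"
    using convex_onD[OF h, of "1 / t" 0 t] t by simp
  then have "t * h 1 \<le> (t - 1) * h 0 + h t" using t by (simp add: field_simps)
  with le[OF t(1)] t(2) show False by (simp add: algebra_simps)
qed

text \<open>
  The hypotheses on \<open>M\<close> and \<open>N\<close> bound the slope, in the direction \<open>w\<close> at infinity, of the given upper
  bound for \<open>U\<close>.
\<close>
lemma line_convex_growth:
  assumes U: "line_convex U" and A: "A \<ge> 0" and K: "K \<ge> 0"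
    and le: "\<And>x. U x \<le> A * ln (\<Sum>l\<le>m. exp (x l)) + K * ln (\<Sum>l\<le>k. exp (x l))"
    and M: "\<And>l. l \<le> m \<Longrightarrow> w l \<le> M" and N: "\<And>l. l \<le> k \<Longrightarrow> w l \<le> N"
  shows "U (\<lambda>l. x l + w l) \<le> U x + (A * M + K * N)"
proof -
  let ?h = "\<lambda>t. U (\<lambda>l. x l + t * w l)"
  have S: "ln (\<Sum>l\<le>n. exp (x l + t * w l)) \<le> ln (\<Sum>l\<le>n. exp (x l)) + t * M"
    if "t \<ge> 0" "\<And>l. l \<le> n \<Longrightarrow> w l \<le> M" for n t M
  proof -
    have pos: "(\<Sum>l\<le>n. exp (y l)) > 0" for y :: "nat \<Rightarrow> real" by (intro sum_pos) auto
    have "(\<Sum>l\<le>n. exp (x l + t * w l)) \<le> (\<Sum>l\<le>n. exp (x l) * exp (t * M))"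
      using that by (intro sum_mono) (auto simp: exp_add intro!: mult_left_mono)
    also have "\<dots> = (\<Sum>l\<le>n. exp (x l)) * exp (t * M)" by (simp add: sum_distrib_right)
    finally have "ln (\<Sum>l\<le>n. exp (x l + t * w l)) \<le> ln ((\<Sum>l\<le>n. exp (x l)) * exp (t * M))"
      using pos[of "\<lambda>l. x l + t * w l"] pos[of x] by (subst ln_le_cancel_iff) auto
    then show ?thesis using pos[of x] by (simp add: ln_mult)
  qed
  have "?h 1 \<le> ?h 0 + (A * M + K * N)"
  proof (rule convex_le_asymptotic_slope)
    show "convex_on UNIV ?h" using U by (simp add: line_convex_def)
    fix t :: real assume t: "t \<ge> 1"
    have "?h t \<le> A * ln (\<Sum>l\<le>m. exp (x l + t * w l)) + K * ln (\<Sum>l\<le>k. exp (x l + t * w l))"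
      by (rule le)
    also have "\<dots> \<le> A * (ln (\<Sum>l\<le>m. exp (x l)) + t * M) + K * (ln (\<Sum>l\<le>k. exp (x l)) + t * N)"
      using A K t M N by (intro add_mono mult_left_mono S) auto
    finally show "?h t \<le> (A * ln (\<Sum>l\<le>m. exp (x l)) + K * ln (\<Sum>l\<le>k. exp (x l))) + t * (A * M + K * N)"
      by (simp add: algebra_simps)
  qed
  then show ?thesis by simp
qed

section \<open>The torus orbits in the blow-up\<close>

text \<open>The first \<open>k + 1\<close> coordinates of a vector, as an element of \<open>Cn {..k}\<close>.\<close>
definition truncate :: "nat \<Rightarrow> cvec \<Rightarrow> cvec" where
  "truncate k z = (\<lambda>l. if l \<le> k then z l else 0)"

text \<open>
  The point of the blow-up over \<open>[z]\<close>, when \<open>[z]\<close> is not in the centre of the blow-up: there the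
  coordinates \<open>\<zeta>\<close> are determined by \<open>z\<close>.
\<close>
definition graph_point :: "nat \<Rightarrow> cvec \<Rightarrow> cvec set \<times> cvec set" where
  "graph_point k z = bpoint z (truncate k z)"

text \<open>The vector with positive coordinates and \<open>ln |z\<^sub>l|\<^sup>2 = x\<^sub>l\<close> for \<open>l \<le> m\<close>.\<close>
definition log_vec :: "nat \<Rightarrow> (nat \<Rightarrow> real) \<Rightarrow> cvec" where
  "log_vec m x = (\<lambda>l. if l \<le> m then complex_of_real (exp (x l / 2)) else 0)"

text \<open>
  The potential of the metric with \<open>\<phi>\<close> added, in homogeneous logarithmic coordinates. Adding \<open>c\<close> to
  all \<open>x\<^sub>l\<close> leaves the point unchanged and adds \<open>(m+1) c\<close> to the potential.
\<close>
definition potential :: "nat \<Rightarrow> nat \<Rightarrow> (cvec set \<times> cvec set \<Rightarrow> real) \<Rightarrow> (nat \<Rightarrow> real) \<Rightarrow> real" where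
  "potential m k \<phi> x = real (m + 1 - k) * ln (\<Sum>l\<le>m. exp (x l)) + real k * ln (\<Sum>l\<le>k. exp (x l)) +
     \<phi> (graph_point k (log_vec m x))"

lemma chart_point_dense: "chart_point k 0 0 u = graph_point k (u(0 := 1))"
  by (auto simp: chart_point_def graph_point_def proj1_def proj2_def truncate_def fun_eq_iff
      intro!: arg_cong2[of _ _ _ _ bpoint])

lemma graph_point_scale: "c \<noteq> 0 \<Longrightarrow> graph_point k (\<lambda>l. c * z l) = graph_point k z"
  using pline_scale[of c z] pline_scale[of c "truncate k z"]
  by (simp add: graph_point_def bpoint_def truncate_def if_distrib cong: if_cong)

lemma graph_point_in_blowup:
  assumes "k \<le> m" "z \<in> Cn {..m}" "i \<le> k" "z i \<noteq> 0"
  shows "graph_point k z \<in> blowup m k"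
proof -
  have "1 * z l + (- 1) * truncate k z l = 0" if "l \<le> k" for l using that by (simp add: truncate_def)
  then have "\<exists>a b. (a \<noteq> 0 \<or> b \<noteq> 0) \<and> (\<forall>l\<le>k. a * z l + b * truncate k z l = 0)"
    by (intro exI[of _ 1] exI[of _ "-1"]) auto
  moreover have "z \<noteq> (\<lambda>_. 0)" "truncate k z \<noteq> (\<lambda>_. 0)"
    using assms by (auto simp: fun_eq_iff truncate_def)
  moreover have "truncate k z \<in> Cn {..k}" by (simp add: Cn_def truncate_def)
  ultimately have "(z, truncate k z) \<in> homog_coords m k"
    using assms by (auto simp: homog_coords_def)
  then show ?thesis unfolding blowup_def graph_point_def by force
qed

lemma invariant_coord_map:
  assumes inv: "invariant m k \<phi>" and T: "T \<in> coord_maps m k" and hom: "\<And>c z. T (\<lambda>l. c * z l) = (\<lambda>l. c * T z l)"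
    and tr: "truncate k (T z) = T (truncate k z)" and z: "graph_point k z \<in> blowup m k"
  shows "\<phi> (graph_point k (T z)) = \<phi> (graph_point k z)"
proof -
  have p: "T ` pline w = pline (T w)" for w
    unfolding pline_def using hom by (auto simp: image_iff) metis+
  have "induced T \<circ> id \<in> aut_group m k" using T by (intro aut_group.intros)
  then have "\<phi> (induced T (graph_point k z)) = \<phi> (graph_point k z)"
    using inv z unfolding invariant_def by auto
  then show ?thesis by (simp add: induced_def graph_point_def bpoint_def p tr)
qed

lemma unit_complex_eq_exp:
  assumes "cmod e = 1"
  obtains \<theta> where "\<theta> \<in> {0..2 * pi}" "e = exp (\<i> * of_real \<theta>)"
proof
  have "e = of_real (cmod e) * exp (\<i> * of_real (Arg2pi e))" by (rule Arg2pi_eq)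
  then show "e = exp (\<i> * of_real (Arg2pi e))" using assms by simp
  show "Arg2pi e \<in> {0..2 * pi}" using Arg2pi_ge_0[of e] Arg2pi_lt_2pi[of e] by simp
qed

lemma invariant_rotations:
  assumes inv: "invariant m k \<phi>" and km: "k \<le> m" and z: "z \<in> Cn {..m}" "i \<le> k" "z i \<noteq> 0"
    and e: "\<And>l. cmod (e l) = 1"
  shows "\<phi> (graph_point k (\<lambda>l. e l * z l)) = \<phi> (graph_point k z)"
proof -
  have "\<phi> (graph_point k (\<lambda>l. if l < n then e l * z l else z l)) = \<phi> (graph_point k z)"
    if "n \<le> Suc m" for n
    using that
  proof (induction n)
    case 0
    then show ?case by simp
  next
    case (Suc n)
    let ?w = "\<lambda>l. if l < n then e l * z l else z l"
    obtain \<theta> where \<theta>: "\<theta> \<in> {0..2 * pi}" "e n = exp (\<i> * of_real \<theta>)"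
      using unit_complex_eq_exp[OF e] by blast
    let ?T = "rotate_coord n \<theta>"
    have "e l \<noteq> 0" for l using e[of l] by auto
    then have w: "?w \<in> Cn {..m}" "?w i \<noteq> 0" using z by (auto simp: Cn_def)
    have "\<phi> (graph_point k (?T ?w)) = \<phi> (graph_point k ?w)"
    proof (rule invariant_coord_map[OF inv])
      show "?T \<in> coord_maps m k" using Suc.prems \<theta> by (auto simp: coord_maps_def)
      show "graph_point k ?w \<in> blowup m k" by (rule graph_point_in_blowup[OF km w(1) z(2) w(2)])
    qed (auto simp: rotate_coord_def truncate_def fun_eq_iff)
    moreover have "?T ?w = (\<lambda>l. if l < Suc n then e l * z l else z l)"
      using \<theta> by (auto simp: rotate_coord_def fun_eq_iff less_Suc_eq)
    ultimately show ?case using Suc by simp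
  qed
  from this[of "Suc m"] have "\<phi> (graph_point k (\<lambda>l. if l < Suc m then e l * z l else z l)) = \<phi> (graph_point k z)"
    by simp
  moreover have "(\<lambda>l. if l < Suc m then e l * z l else z l) = (\<lambda>l. e l * z l)"
    using z(1) by (auto simp: Cn_def fun_eq_iff)
  ultimately show ?thesis by simp
qed

lemma log_vec_Cn: "log_vec m x \<in> Cn {..m}" "l \<le> m \<Longrightarrow> log_vec m x l \<noteq> 0"
  by (auto simp: log_vec_def Cn_def)

lemma invariant_exchange:
  assumes inv: "invariant m k \<phi>" and km: "k \<le> m"
    and ij: "i \<le> k \<and> j \<le> k \<or> i \<in> {k+1..m} \<and> j \<in> {k+1..m}"
  shows "\<phi> (graph_point k (log_vec m (x \<circ> Transposition.transpose i j))) = \<phi> (graph_point k (log_vec m x))"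
proof -
  have "\<phi> (graph_point k (exchange i j (log_vec m x))) = \<phi> (graph_point k (log_vec m x))"
  proof (rule invariant_coord_map[OF inv])
    show "exchange i j \<in> coord_maps m k" using ij unfolding coord_maps_def by blast
    show "graph_point k (log_vec m x) \<in> blowup m k"
      using graph_point_in_blowup[OF km log_vec_Cn(1), of 0] log_vec_Cn(2)[of 0 m x] by simp
  qed (use ij in \<open>auto simp: exchange_def truncate_def fun_eq_iff Transposition.transpose_def\<close>)
  moreover have "exchange i j (log_vec m x) = log_vec m (x \<circ> Transposition.transpose i j)"
    using ij km by (auto simp: exchange_def log_vec_def fun_eq_iff Transposition.transpose_def)
  ultimately show ?thesis by simp
qed

text \<open>
  A point without vanishing coordinates is in the torus orbit, and rotations make its coordinates
  positive.
\<close>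
lemma bpoint_eq_log_vec:
  assumes inv: "invariant m k \<phi>" and km: "k \<le> m"
    and h: "(z, \<zeta>) \<in> homog_coords m k" and z: "\<And>l. l \<le> m \<Longrightarrow> z l \<noteq> 0"
  obtains c where "c \<noteq> 0" "\<zeta> = (\<lambda>l. c * truncate k z l)"
    "\<phi> (bpoint z \<zeta>) = \<phi> (graph_point k (log_vec m (\<lambda>l. 2 * ln (cmod (z l)))))"
proof -
  from h have zC: "z \<in> Cn {..m}" and \<zeta>: "\<zeta> \<in> Cn {..k}" "\<zeta> \<noteq> (\<lambda>_. 0)"
    by (auto simp: homog_coords_def)
  from h obtain a b where ab: "a \<noteq> 0 \<or> b \<noteq> 0" "\<And>i. i \<le> k \<Longrightarrow> a * z i + b * \<zeta> i = 0"
    by (auto simp: homog_coords_def)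
  have b: "b \<noteq> 0" using ab(1) ab(2)[of 0] z[of 0] by auto
  define c where "c = - a / b"
  have \<zeta>c: "\<zeta> = (\<lambda>l. c * truncate k z l)"
  proof
    fix l
    show "\<zeta> l = c * truncate k z l"
    proof (cases "l \<le> k")
      case True
      then show ?thesis using ab(2)[OF True] b by (simp add: c_def truncate_def field_simps add_eq_0_iff)
    qed (use \<zeta>(1) in \<open>simp add: Cn_def truncate_def\<close>)
  qed
  have c: "c \<noteq> 0" using \<zeta>(2) \<zeta>c by auto
  let ?x = "\<lambda>l. 2 * ln (cmod (z l))"
  have "(\<lambda>l. (if l \<le> m then sgn (z l) else 1) * log_vec m ?x l) = z"
    using zC z by (auto simp: log_vec_def fun_eq_iff Cn_def sgn_div_norm scaleR_conv_of_real)
  moreover have "\<phi> (graph_point k (\<lambda>l. (if l \<le> m then sgn (z l) else 1) * log_vec m ?x l)) = \<phi> (graph_point k (log_vec m ?x))"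
    using z by (intro invariant_rotations[OF inv km log_vec_Cn(1), of 0]) (auto simp: norm_sgn log_vec_Cn(2))
  moreover have "bpoint z \<zeta> = graph_point k z"
    unfolding graph_point_def bpoint_def using pline_scale[OF c, of "truncate k z"] \<zeta>c by simp
  ultimately show ?thesis using that[OF c \<zeta>c] by simp
qed

text \<open>
  In the dense chart the coordinates are \<open>x\<^sub>l - x\<^sub>0\<close>; the homogeneous potential differs from the local
  one by the linear function \<open>(m+1) x\<^sub>0\<close>.
\<close>
lemma line_convex_potential:
  assumes km: "k < m" and sm: "smooth_on_blowup m k \<phi>" and adm: "admissible m k \<phi>" and inv: "invariant m k \<phi>"
  shows "line_convex (potential m k \<phi>)"
  unfolding line_convex_def
proof (intro allI)
  fix x y :: "nat \<Rightarrow> real"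
  define \<gamma> where "\<gamma> = (\<lambda>t l. if l \<in> {1..m} then complex_of_real (exp (((x l - x 0) + t * (y l - y 0)) / 2)) else 0)"
  let ?W = "\<lambda>t. real (m + 1 - k) * ln (1 + (\<Sum>l=1..m. (cmod (\<gamma> t l))\<^sup>2)) +
    real k * ln (1 + (\<Sum>l=1..k. (cmod (\<gamma> t l))\<^sup>2)) + \<phi> (chart_point k 0 0 (\<gamma> t))"
  let ?s = "\<lambda>t. x 0 + t * y 0"
  have inv0: "\<phi> (chart_point k 0 0 (\<lambda>l. e l * u l)) = \<phi> (chart_point k 0 0 u)"
    if u: "u \<in> Cn {1..m}" and e: "\<And>l. cmod (e l) = 1" for u e
  proof -
    have "\<phi> (graph_point k (\<lambda>l. (e(0 := 1)) l * (u(0 := 1)) l)) = \<phi> (graph_point k (u(0 := 1)))"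
    proof (rule invariant_rotations[OF inv])
      show "u(0 := 1) \<in> Cn {..m}" using u by (auto simp: Cn_def)
      show "(u(0 := 1)) 0 \<noteq> 0" by simp
    qed (use km e in auto)
    moreover have "(\<lambda>l. e l * u l)(0 := 1) = (\<lambda>l. (e(0 := 1)) l * (u(0 := 1)) l)" by auto
    ultimately show ?thesis unfolding chart_point_dense by simp
  qed
  have W: "convex_on UNIV ?W"
    unfolding \<gamma>_def by (rule convex_potential_dense_chart[OF km sm adm inv0])
  have "potential m k \<phi> (\<lambda>l. x l + t * y l) = ?W t + real (m + 1) * ?s t" for t
  proof -
    have ln_eq: "ln (\<Sum>l\<le>n. exp (x l + t * y l)) = ?s t + ln (1 + (\<Sum>l=1..n. (cmod (\<gamma> t l))\<^sup>2))" if "n \<le> m" for n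
    proof -
      have "(cmod (\<gamma> t l))\<^sup>2 = exp (x l + t * y l - ?s t)" if "l \<in> {1..n}" for l
        using that \<open>n \<le> m\<close> by (simp add: \<gamma>_def power2_eq_square mult_exp_exp) (simp add: field_simps)
      then have "exp (?s t) * (1 + (\<Sum>l=1..n. (cmod (\<gamma> t l))\<^sup>2)) = exp (?s t) + (\<Sum>l=1..n. exp (?s t) * exp (x l + t * y l - ?s t))"
        by (simp add: distrib_left sum_distrib_left)
      also have "\<dots> = (\<Sum>l\<le>n. exp (x l + t * y l))"
        by (simp add: mult_exp_exp atMost_atLeast0 sum.atLeast_Suc_atMost)
      finally have "(\<Sum>l\<le>n. exp (x l + t * y l)) = exp (?s t) * (1 + (\<Sum>l=1..n. (cmod (\<gamma> t l))\<^sup>2))" ..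
      moreover have "1 + (\<Sum>l=1..n. (cmod (\<gamma> t l))\<^sup>2) > 0" by (intro add_pos_nonneg sum_nonneg) auto
      ultimately show ?thesis by (simp add: ln_mult)
    qed
    have "log_vec m (\<lambda>l. x l + t * y l) = (\<lambda>l. of_real (exp (?s t / 2)) * ((\<gamma> t)(0 := 1)) l)"
      by (auto simp: log_vec_def \<gamma>_def fun_eq_iff of_real_mult[symmetric] mult_exp_exp simp del: of_real_mult)
        (auto simp: field_simps)
    then have gp: "graph_point k (log_vec m (\<lambda>l. x l + t * y l)) = chart_point k 0 0 (\<gamma> t)"
      unfolding chart_point_dense by (simp only: graph_point_scale of_real_eq_0_iff exp_not_eq_zero not_False_eq_True)
    have alg: "A * (s + p) + K * (s + q) + r = A * p + K * q + r + M * s" if "M = A + K" for A K M p q r s :: real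
      by (simp add: that algebra_simps)
    have "real (m + 1) = real (m + 1 - k) + real k" using km by simp
    from alg[OF this] show ?thesis
      unfolding potential_def gp ln_eq[OF order_refl] ln_eq[OF less_imp_le[OF km]] .
  qed
  moreover have "convex_on UNIV (\<lambda>t. ?W t + real (m + 1) * ?s t)"
  proof (rule convex_on_add[OF W])
    show "convex_on UNIV (\<lambda>t. real (m + 1) * ?s t)"
      by (rule f''_ge0_imp_convex[where f' = "\<lambda>_. real (m + 1) * y 0" and f'' = "\<lambda>_. 0"])
        (auto intro!: derivative_eq_intros)
  qed
  ultimately show "convex_on UNIV (\<lambda>t. potential m k \<phi> (\<lambda>l. x l + t * y l))" by simp
qed

text \<open>
  The supremum of \<open>\<phi>\<close> is approached on the torus orbit: replacing the vanishing coordinates by a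
  small \<open>s > 0\<close> in a chart around \<open>p\<close> moves \<open>p\<close> into this orbit.
\<close>
lemma exists_log_vec_above:
  assumes km: "k < m" and sm: "smooth_on_blowup m k \<phi>" and inv: "invariant m k \<phi>"
    and p: "p \<in> blowup m k" and r: "r < \<phi> p"
  obtains x where "r < \<phi> (graph_point k (log_vec m x))"
proof -
  obtain i j u where ij: "(i, j) \<in> charts m k" and u: "u \<in> Cn ({..m} - {j})" and pe: "p = chart_point k i j u"
    using p unfolding blowup_eq_charts[OF km] by auto
  let ?I = "{..m} - {j}"
  define w where "w = (\<lambda>s l. if l \<in> ?I \<and> u l = 0 then complex_of_real s else u l)"
  have wC: "w s \<in> Cn ?I" for s using u by (auto simp: w_def Cn_def)
  have "((\<lambda>s. w s l) \<longlongrightarrow> u l) (at_right 0)" for l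
  proof (cases "l \<in> ?I \<and> u l = 0")
    case True
    have "((\<lambda>s. complex_of_real s) \<longlongrightarrow> of_real 0) (at_right 0)" by (intro tendsto_intros)
    then show ?thesis using True by (simp add: w_def)
  qed (auto simp: w_def)
  then have w_lim: "(w \<longlongrightarrow> u) (at_right 0)" by (rule tendsto_coordinatewise)
  have "smooth_on_Cn ?I (\<lambda>u. \<phi> (chart_point k i j u))"
    using bspec[OF sm[unfolded smooth_on_blowup_def] ij] by simp
  then have "continuous_on (Cn ?I) (\<lambda>u. \<phi> (chart_point k i j u))"
    unfolding smooth_on_Cn_def using Ck_continuous by blast
  then have "((\<lambda>s. \<phi> (chart_point k i j (w s))) \<longlongrightarrow> \<phi> p) (at_right 0)"
    unfolding pe by (rule continuous_on_tendsto_compose[OF _ w_lim u]) (simp add: wC)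
  then have "eventually (\<lambda>s. r < \<phi> (chart_point k i j (w s))) (at_right 0)"
    using r by (rule order_tendstoD)
  then have "eventually (\<lambda>s. r < \<phi> (chart_point k i j (w s)) \<and> 0 < s) (at_right (0::real))"
    by (intro eventually_conj eventually_at_right_less)
  then obtain s where s: "r < \<phi> (chart_point k i j (w s))" "s > 0"
    using eventually_happens'[OF trivial_limit_at_right_real] by blast
  have w_ne: "w s l \<noteq> 0" if "l \<in> ?I" for l using s that by (simp add: w_def)
  let ?z = "(proj1 k i j (w s))(j := 1)" and ?\<zeta> = "(proj2 k i (w s))(i := 1)"
  have coll: "1 * ?z l + (- ?z i) * ?\<zeta> l = 0" if "l \<le> k" for l
    using ij that by (auto simp: charts_def proj1_def proj2_def)
  have "?z \<in> Cn {..m}" "?\<zeta> \<in> Cn {..k}"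
    using ij wC[of s] km by (auto simp: charts_def proj1_def proj2_def Cn_def)
  moreover have "?z \<noteq> (\<lambda>_. 0)" "?\<zeta> \<noteq> (\<lambda>_. 0)" by (auto simp: fun_eq_iff)
  moreover have "\<exists>a b. (a \<noteq> 0 \<or> b \<noteq> 0) \<and> (\<forall>l\<le>k. a * ?z l + b * ?\<zeta> l = 0)"
    using coll by (intro exI[of _ 1] exI[of _ "- ?z i"]) auto
  ultimately have h: "(?z, ?\<zeta>) \<in> homog_coords m k" by (auto simp: homog_coords_def)
  have "?z l \<noteq> 0" if "l \<le> m" for l
    using that ij km w_ne by (auto simp: proj1_def charts_def)
  then obtain x where "\<phi> (bpoint ?z ?\<zeta>) = \<phi> (graph_point k (log_vec m x))"
    using bpoint_eq_log_vec[OF inv less_imp_le[OF km] h] by blast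
  with s(1) show ?thesis by (intro that[of x]) (simp add: chart_point_def)
qed

section \<open>The lower bound\<close>

lemma potential_le:
  assumes "k \<le> m" and le: "\<And>p. p \<in> blowup m k \<Longrightarrow> \<phi> p \<le> 0"
  shows "potential m k \<phi> x \<le> real (m + 1 - k) * ln (\<Sum>l\<le>m. exp (x l)) + real k * ln (\<Sum>l\<le>k. exp (x l))"
proof -
  have "graph_point k (log_vec m x) \<in> blowup m k"
    using graph_point_in_blowup[OF assms(1) log_vec_Cn(1), of 0] log_vec_Cn(2)[of 0 m x] by simp
  from le[OF this] show ?thesis by (simp add: potential_def)
qed

text \<open>
  The bound for vectors constant on both blocks. If it failed, the left-hand side would exceed the
  potential by \<open>-r > 0\<close>, and there would be a torus point \<open>x\<close> with \<open>\<phi> > r\<close>; comparing \<open>x\<close> and \<open>y\<close> by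
  the growth estimate gives \<open>\<phi> \<le> r\<close> at \<open>x\<close>.
\<close>
lemma potential_block_ge:
  assumes km: "k < m" and sm: "smooth_on_blowup m k \<phi>" and adm: "admissible m k \<phi>"
    and inv: "invariant m k \<phi>" and sup: "(SUP p\<in>blowup m k. ereal (\<phi> p)) = 0"
    and y: "\<And>l. l \<le> k \<Longrightarrow> y l = a" "\<And>l. k < l \<Longrightarrow> l \<le> m \<Longrightarrow> y l = b"
  shows "real (m + 1 - k) * min a b + real k * a \<le> potential m k \<phi> y"
proof (rule ccontr)
  let ?A = "real (m + 1 - k)" and ?K = "real k"
  define r where "r = potential m k \<phi> y - (?A * min a b + ?K * a)"
  assume "\<not> ?thesis"
  then have "ereal r < (SUP p\<in>blowup m k. ereal (\<phi> p))" unfolding sup r_def by simp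
  then obtain p where p: "p \<in> blowup m k" "r < \<phi> p" by (auto simp: less_SUP_iff)
  then obtain x where x: "r < \<phi> (graph_point k (log_vec m x))"
    using exists_log_vec_above[OF km sm inv] by blast
  have le0: "\<phi> p \<le> 0" if "p \<in> blowup m k" for p
    using SUP_upper[OF that, of "\<lambda>p. ereal (\<phi> p)"] sup by simp
  have x_le: "x l \<le> ln (\<Sum>l\<le>n. exp (x l))" if "l \<le> n" for l n
  proof -
    have "exp (x l) \<le> (\<Sum>l\<le>n. exp (x l))" using that by (intro member_le_sum) auto
    from ln_mono[OF this exp_gt_zero] show ?thesis by simp
  qed
  have "potential m k \<phi> (\<lambda>l. y l + (x l - y l)) \<le> potential m k \<phi> y +
      (?A * (ln (\<Sum>l\<le>m. exp (x l)) - min a b) + ?K * (ln (\<Sum>l\<le>k. exp (x l)) - a))"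
  proof (rule line_convex_growth[OF line_convex_potential[OF km sm adm inv]])
    show "potential m k \<phi> x \<le> ?A * ln (\<Sum>l\<le>m. exp (x l)) + ?K * ln (\<Sum>l\<le>k. exp (x l))" for x
      using km le0 by (intro potential_le) auto
    show "x l - y l \<le> ln (\<Sum>l\<le>m. exp (x l)) - min a b" if "l \<le> m" for l
    proof -
      have "min a b \<le> y l" using y[of l] that by (cases "l \<le> k") auto
      with x_le[OF that] show ?thesis by linarith
    qed
    show "x l - y l \<le> ln (\<Sum>l\<le>k. exp (x l)) - a" if "l \<le> k" for l
      using x_le[OF that] y(1)[OF that] by simp
  qed auto
  then have "\<phi> (graph_point k (log_vec m x)) \<le> r"
    by (simp add: potential_def r_def algebra_simps)
  with x show False by simp
qed

lemma potential_ge: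
  assumes km: "k < m" and sm: "smooth_on_blowup m k \<phi>" and adm: "admissible m k \<phi>"
    and inv: "invariant m k \<phi>" and sup: "(SUP p\<in>blowup m k. ereal (\<phi> p)) = 0"
  defines "a \<equiv> \<lambda>x. (\<Sum>l\<le>k. x l) / real (k + 1)" and "b \<equiv> \<lambda>x. (\<Sum>l=k+1..m. x l) / real (m - k)"
  shows "real (m + 1 - k) * min (a x) (b x) + real k * a x \<le> potential m k \<phi> x"
proof -
  have sym: "potential m k \<phi> (x \<circ> Transposition.transpose i j) = potential m k \<phi> x"
    if ij: "i \<le> k \<and> j \<le> k \<or> i \<in> {k+1..m} \<and> j \<in> {k+1..m}" for x i j
  proof -
    have S: "(\<Sum>l\<le>n. exp ((x \<circ> Transposition.transpose i j) l)) = (\<Sum>l\<le>n. exp (x l))"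
      if "i \<le> n \<and> j \<le> n \<or> n < i \<and> n < j" for n
      by (rule sum.reindex_bij_witness[of _ "Transposition.transpose i j" "Transposition.transpose i j"])
        (use that in \<open>auto simp: Transposition.transpose_def split: if_splits\<close>)
    show ?thesis unfolding potential_def
      using invariant_exchange[OF inv _ ij] S[of m] S[of k] ij km by auto
  qed
  \<comment> \<open>Averaging over the first block, then over the second.\<close>
  define x1 where "x1 = (\<lambda>i. if i \<in> {..k} then (\<Sum>s\<in>{..k}. x s) / card {..k} else x i)"
  define x2 where "x2 = (\<lambda>i. if i \<in> {k+1..m} then (\<Sum>s\<in>{k+1..m}. x1 s) / card {k+1..m} else x1 i)"
  note U = line_convex_potential[OF km sm adm inv]
  have 1: "potential m k \<phi> x1 \<le> potential m k \<phi> x"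
    unfolding x1_def by (rule line_convex_average[OF U]) (use sym in auto)
  have 2: "potential m k \<phi> x2 \<le> potential m k \<phi> x1"
    unfolding x2_def by (rule line_convex_average[OF U]) (use sym km in auto)
  have "real (m + 1 - k) * min (a x) (b x) + real k * a x \<le> potential m k \<phi> x2"
  proof (rule potential_block_ge[OF km sm adm inv sup])
    show "x2 l = a x" if "l \<le> k" for l using that by (simp add: x2_def x1_def a_def)
    show "x2 l = b x" if "k < l" "l \<le> m" for l using that km by (simp add: x2_def x1_def b_def)
  qed
  with 1 2 show ?thesis by linarith
qed

text \<open>
  The envelope in logarithmic coordinates. The factor \<open>c\<close> between \<open>\<zeta>\<close> and \<open>z\<close> cancels, since numerator
  and denominator are homogeneous in \<open>\<zeta>\<close> of the same degree.
\<close>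
lemma psi_eq:
  fixes z :: cvec
  assumes km: "k < m" and z: "\<And>l. l \<le> m \<Longrightarrow> z l \<noteq> 0" and c: "c \<noteq> 0" and \<zeta>: "\<zeta> = (\<lambda>l. c * truncate k z l)"
  defines "x \<equiv> \<lambda>l. 2 * ln (cmod (z l))"
  defines "a \<equiv> (\<Sum>l\<le>k. x l) / real (k + 1)" and "b \<equiv> (\<Sum>l=k+1..m. x l) / real (m - k)"
  shows "psi m k z \<zeta> = ereal (real (m + 1 - k) * min a b + real k * a -
    real (m + 1 - k) * ln (\<Sum>l\<le>m. exp (x l)) - real k * ln (\<Sum>l\<le>k. exp (x l)))"
proof -
  let ?A = "m + 1 - k"
  have log: "eln (P powr p * Q powr q / (S ^ r * T ^ n)) = ereal (p * ln P + q * ln Q - real r * ln S - real n * ln T)"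
    if "P > 0" "Q > 0" "S > 0" "T > 0" for P Q S T p q :: real and r n
    using that by (simp add: eln_def ln_div ln_mult ln_powr ln_realpow)
  have ex: "(cmod (z l))\<^sup>2 = exp (x l)" if "l \<le> m" for l
    using z[OF that] by (simp add: x_def exp_double)
  have lnprod: "ln (\<Prod>i\<in>B. cmod (z i)) = (\<Sum>i\<in>B. x i) / 2" "(\<Prod>i\<in>B. cmod (z i)) > 0" if "B \<subseteq> {..m}" for B
  proof -
    have nz: "cmod (z i) > 0" if "i \<in> B" for i using z[of i] that \<open>B \<subseteq> {..m}\<close> by auto
    then show "(\<Prod>i\<in>B. cmod (z i)) > 0" by (rule prod_pos)
    have "ln (\<Prod>i\<in>B. cmod (z i)) = (\<Sum>i\<in>B. ln (cmod (z i)))"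
      using nz finite_subset[OF that] by (intro ln_prod) auto
    then show "ln (\<Prod>i\<in>B. cmod (z i)) = (\<Sum>i\<in>B. x i) / 2" by (simp add: x_def sum_distrib_left[symmetric])
  qed
  have S: "(\<Sum>i\<in>{0..m}. (cmod (z i))\<^sup>2) = (\<Sum>l\<le>m. exp (x l))"
    by (simp add: ex atMost_atLeast0)
  have T: "(\<Sum>i\<in>{0..k}. (cmod (\<zeta> i))\<^sup>2) = (cmod c)\<^sup>2 * (\<Sum>l\<le>k. exp (x l))"
    unfolding sum_distrib_left atMost_atLeast0 using km
    by (intro sum.cong refl) (simp add: \<zeta> truncate_def norm_mult power_mult_distrib ex)
  have Q: "(\<Prod>i\<in>{0..k}. cmod (\<zeta> i)) = cmod c ^ (k + 1) * (\<Prod>i\<in>{0..k}. cmod (z i))"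
    by (simp add: \<zeta> truncate_def norm_mult prod.distrib)
  have pos: "(\<Sum>l\<le>n. exp (x l)) > 0" for n by (intro sum_pos) auto
  have sumk: "(\<Sum>i\<in>{0..k}. x i) = real (k + 1) * a" by (simp add: a_def atMost_atLeast0)
  have summ: "(\<Sum>i\<in>{k+1..m}. x i) = real (m - k) * b" using km by (simp add: b_def)
  have lnT: "ln ((cmod c)\<^sup>2 * (\<Sum>l\<le>k. exp (x l))) = 2 * ln (cmod c) + ln (\<Sum>l\<le>k. exp (x l))"
    using c pos[of k] by (simp add: ln_mult ln_realpow)
  have sub: "{0..k} \<subseteq> {..m}" "{k+1..m} \<subseteq> {..m}" using km by auto
  have lnQ: "ln (cmod c ^ (k + 1) * (\<Prod>i\<in>{0..k}. cmod (z i))) = real (k + 1) * ln (cmod c) + real (k + 1) * a / 2"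
  proof -
    have "ln (cmod c ^ (k + 1) * P) = real (k + 1) * ln (cmod c) + ln P" if "P > 0" for P
      using that c by (simp add: ln_mult ln_realpow del: power_Suc)
    then show ?thesis by (simp only: lnprod[OF sub(1)] sumk)
  qed
  have \<zeta>part: "2 * real k / real (k + 1) * (real (k + 1) * ln (cmod c) + real (k + 1) * a / 2) = real k * (2 * ln (cmod c) + a)"
    by (simp add: field_simps del: of_nat_Suc)
  have cp: "(cmod c)\<^sup>2 * (\<Sum>l\<le>k. exp (x l)) > 0" "cmod c ^ (k + 1) * (\<Prod>i\<in>{0..k}. cmod (z i)) > 0"
    using c pos lnprod(2)[OF sub(1)] by auto
  have p1: "2 * real ?A / real (k + 1) * (real (k + 1) * a / 2) = real ?A * a"
    by (simp add: field_simps del: of_nat_Suc)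
  have p2: "2 * real ?A / real (m - k) * (real (m - k) * b / 2) = real ?A * b"
    using km by simp
  let ?R = "real ?A * ln (\<Sum>l\<le>m. exp (x l)) + real k * ln (\<Sum>l\<le>k. exp (x l))"
  have psi1: "psi1 m k z \<zeta> = ereal (real ?A * a + real k * a - ?R)"
    unfolding psi1_def S T Q log[OF lnprod(2)[OF sub(1)] cp(2) pos cp(1)] lnQ lnT lnprod(1)[OF sub(1)] sumk \<zeta>part p1
    by (simp add: algebra_simps)
  have psi2: "psi2 m k z \<zeta> = ereal (real ?A * b + real k * a - ?R)"
    unfolding psi2_def S T Q log[OF lnprod(2)[OF sub(2)] cp(2) pos cp(1)] lnQ lnT lnprod(1)[OF sub(2)] summ \<zeta>part p2
    by (simp add: algebra_simps)
  have "real ?A * min a b = min (real ?A * a) (real ?A * b)" by (simp add: min_mult_distrib_left)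
  moreover have "inf (ereal (p + q - r)) (ereal (p' + q - r)) = ereal (min p p' + q - r)" for p p' q r
    by (auto simp: inf_min min_def)
  ultimately show ?thesis unfolding psi_def psi1 psi2 by (simp only: diff_diff_eq)
qed

lemma psi_eq_MInfty:
  assumes "k < m" "l \<le> m" "z l = 0"
  shows "psi m k z \<zeta> = -\<infinity>"
proof (cases "l \<le> k")
  case True
  then have "(\<Prod>i\<in>{0..k}. cmod (z i)) = 0" using assms by auto
  then have "psi1 m k z \<zeta> = -\<infinity>" unfolding psi1_def eln_def by simp
  then show ?thesis by (simp add: psi_def inf_min)
next
  case False
  then have "(\<Prod>i\<in>{k+1..m}. cmod (z i)) = 0" using assms by auto
  then have "psi2 m k z \<zeta> = -\<infinity>" unfolding psi2_def eln_def by simp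
  then show ?thesis by (simp add: psi_def inf_min)
qed

theorem mainTheorem3:
  fixes m k :: nat and \<phi> :: "cvec set \<times> cvec set \<Rightarrow> real"
  assumes "2 \<le> m" and "1 \<le> k" and "k \<le> m - 1"
    and "smooth_on_blowup m k \<phi>"
    and "admissible m k \<phi>"
    and "invariant m k \<phi>"
    and "(SUP x\<in>blowup m k. ereal (\<phi> x)) = 0"
  shows "\<forall>(z, \<zeta>)\<in>homog_coords m k. psi m k z \<zeta> \<le> ereal (\<phi> (bpoint z \<zeta>))"
proof clarify
  fix z \<zeta> assume h: "(z, \<zeta>) \<in> homog_coords m k"
  have km: "k < m" using assms by linarith
  show "psi m k z \<zeta> \<le> ereal (\<phi> (bpoint z \<zeta>))"
  proof (cases "\<exists>l\<le>m. z l = 0")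
    case True
    then show ?thesis using psi_eq_MInfty[OF km] by auto
  next
    case False
    then have z: "\<And>l. l \<le> m \<Longrightarrow> z l \<noteq> 0" by blast
    obtain c where c: "c \<noteq> 0" "\<zeta> = (\<lambda>l. c * truncate k z l)"
      and \<phi>: "\<phi> (bpoint z \<zeta>) = \<phi> (graph_point k (log_vec m (\<lambda>l. 2 * ln (cmod (z l)))))"
      using bpoint_eq_log_vec[OF assms(6) less_imp_le[OF km] h z] by blast
    show ?thesis
      unfolding \<phi>
      using potential_ge[OF km assms(4-7), of "\<lambda>l. 2 * ln (cmod (z l))"]
      by (subst psi_eq[OF km z c]) (simp_all add: potential_def)
  qed
qed

end
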